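(* Let $\mathcal{K}\subset\mathbb{R}^d$ be a convex and compact polytope, let $f$ be convex and $\beta$-smooth over $\mathcal{K}$, suppose that quadratic growth holds with parameter $\alpha>0$, and suppose that strict complementarity holds with some parameter $\delta>0$. Let $\kappa=\frac{2\mu^2\dim\mathcal{F}^*}{\alpha}$, where $\mu=\frac{\psi}{\xi}$, and let $$M_1\ge\max\left\{\tfrac{4\beta}{\alpha}+8\beta D_{\mathcal{F}^*}^2\max\{2\kappa,\delta^{-1}\},\ \tfrac12\right\},\qquad M_2\ge\max\left\{\tfrac{4\beta}{\alpha}+16\beta\kappa D_{\mathcal{F}^*}^2,\ \tfrac12\right\},\qquad C\ge f(\mathbf{x}_1)-f^*.$$ Let $(\mathbf{x}_t)_{t\ge1}$ be iterates produced by the polytope Frank-Wolfe algorithm with NEP oracle described in the context (with either Option 1 or Option 2). (1) If $\rho_t=\frac{\min\left\{\sqrt{2\max\{2\kappa,\delta^{-1}\}\,C\exp\left(-\frac{1}{4M_1}(t-1)\right)},\,1\right\}}{2M_1}$ for all $t\ge1$, then $$\forall t\ge1:\quad f(\mathbf{x}_t)-f^*\le C\exp\left(-\frac{t-1}{4M_1}\right).$$ (2) Furthermore, suppose that $2\kappa\le\delta^{-1}$ and $\dim\mathcal{F}^*>0$ (i.e. $\kappa>0$), and let $\tau\ge1$ be an integer with $\tau\ge4M_1\log\left(\frac{C}{\delta^2\kappa}\right)+1$. If $\rho_t$ is as in (1) for $t<\tau$, while $\rho_t=\frac{\min\left\{2\delta\kappa\exp\left(-\frac{t-\tau}{8M_2}\right),\,1\right\}}{2M_2}$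 for all $t\ge\tau$, then $$\forall t\ge\tau:\quad f(\mathbf{x}_t)-f^*\le\delta^2\kappa\exp\left(-\frac{t-\tau}{4M_2}\right).$$
   Context: $\|\cdot\|$ is the Euclidean norm, $\|\cdot\|_2$ the spectral norm of a matrix. $\beta$-smooth over $\mathcal{K}$: $f$ is differentiable on a neighbourhood of $\mathcal{K}$ and $\|\nabla f(\mathbf{x})-\nabla f(\mathbf{y})\|\le\beta\|\mathbf{x}-\mathbf{y}\|$ for all $\mathbf{x},\mathbf{y}\in\mathcal{K}$ ($\beta>0$). $f^*=\min_{\mathcal{K}}f$, $\mathcal{X}^*=\arg\min_{\mathbf{x}\in\mathcal{K}}f(\mathbf{x})$, and $\mathcal{V}$ is the set of vertices of $\mathcal{K}$. Quadratic growth with parameter $\alpha>0$: $\mathrm{dist}(\mathbf{x},\mathcal{X}^* )^2\le2\alpha^{-1}(f(\mathbf{x})-f^* )$ for all $\mathbf{x}\in\mathcal{K}$. $\mathcal{K}=\{\mathbf{x}\in\mathbb{R}^d : \mathbf{A}_1\mathbf{x}=\mathbf{b}_1,\ \mathbf{A}_2\mathbf{x}\le\mathbf{b}_2\}$ with $\mathbf{A}_1\in\mathbb{R}^{m_1\times d}$, $\mathbf{A}_2\in\mathbb{R}^{m_2\times d}$; $\mathbf{A}(i)$ denotes the $i$-th row of $\mathbf{A}$ (as a vector). For a face $\mathcal{F}$ of $\mathcal{K}$, $$\dim\mathcal{F}=d-\dim\mathrm{span}\big(\{\mathbf{A}_1(1),\dots,\mathbf{A}_1(m_1)\}\cup\{\mathbf{A}_2(i)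 : i\in[m_2],\ \forall\mathbf{x}\in\mathcal{F}:\ \mathbf{A}_2(i)^\top\mathbf{x}=\mathbf{b}_2(i)\}\big).$$ $\mathcal{F}^*$ is the lowest-dimensional face of $\mathcal{K}$ with $\mathcal{X}^*\subseteq\mathcal{F}^*$, and $D_{\mathcal{F}^*}$ is its Euclidean diameter. Write $\mathcal{F}^*=\{\mathbf{x} : \mathbf{A}_1^*\mathbf{x}=\mathbf{b}_1^*,\ \mathbf{A}_2^*\mathbf{x}\le\mathbf{b}_2^*\}$, where the rows of $\mathbf{A}_1^*$ are the rows of $\mathbf{A}_1$ together with the rows of $\mathbf{A}_2$ whose constraints are tight at all points of $\mathcal{F}^*$, the rows of $\mathbf{A}_2^*$ are the rows of $\mathbf{A}_2$ whose constraints are tight at some points of $\mathcal{F}^*$ but not at others, and $\mathbf{b}_1^*,\mathbf{b}_2^*$ are defined accordingly. $\mathbb{A}^*$ is the set of all $\dim\mathcal{F}^*\times d$ matrices whose rows are linearly independent rows chosen from the rows of $\mathbf{A}_2^*$; $\psi=\max_{\mathbf{M}\in\mathbb{A}^*}\|\mathbf{M}\|_2$; $\xi=\min_{\mathbf{v}\in\mathcal{V}\cap\mathcal{F}^*}\min_i\{\mathbf{b}_2^*(i)-\mathbf{A}_2^*(i)^\top\mathbf{v} : \mathbf{b}_2^*(i)>\mathbf{A}_2^*(i)^\top\mathbf{v}\}$. When $\dim\mathcal{F}^*=0$, $\kappa$ is understood to be $0$. Strict complementarity with parameter $\delta>0$: for all $\mathbf{x}^*\in\mathcal{X}^*$ and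 $\mathbf{v}\in\mathcal{V}$: if $\mathbf{v}\in\mathcal{V}\setminus\mathcal{F}^*$ then $(\mathbf{v}-\mathbf{x}^* )^\top\nabla f(\mathbf{x}^* )\ge\delta$, and if $\mathbf{v}\in\mathcal{V}\cap\mathcal{F}^*$ then $(\mathbf{v}-\mathbf{x}^* )^\top\nabla f(\mathbf{x}^* )=0$. Polytope Frank-Wolfe with NEP (nearest extreme point) oracle, with parameters $\{\rho_t\}_{t\ge1}\subset[0,1]$: $\mathbf{x}_1\in\mathcal{V}$ is arbitrary. For $t=1,2,\dots$: let $\mathbf{x}_t=\sum_{i=1}^k\lambda_i\mathbf{v}_i$ be an explicitly maintained convex decomposition of $\mathbf{x}_t$ into vertices $\mathbf{v}_1,\dots,\mathbf{v}_k\in\mathcal{V}$; compute $\mathbf{v}_{k+1}\in\arg\min_{\mathbf{u}\in\mathcal{V}}\mathbf{u}^\top\nabla f(\mathbf{x}_t)+\beta\rho_t\|\mathbf{u}-\mathbf{x}_t\|^2$; then set either Option 1: $\mathbf{x}_{t+1}\in\arg\min_{\mathbf{x}\in\mathrm{conv}(\mathbf{v}_1,\dots,\mathbf{v}_{k+1})}\mathbf{x}^\top\nabla f(\mathbf{x}_t)+\frac{\beta}{2}\|\mathbf{x}-\mathbf{x}_t\|^2$, or Option 2 (fully-corrective): $\mathbf{x}_{t+1}\in\arg\min_{\mathbf{x}\in\mathrm{conv}(\mathbf{v}_1,\dots,\mathbf{v}_{k+1})}f(\mathbf{x})$. *)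

theory Defs
  imports "HOL-Analysis.Analysis"
begin

text \<open>
  A real matrix with \<open>m\<close> rows and \<open>d\<close> columns, where \<open>d = CARD('d)\<close> and \<open>m = 0\<close> is
  allowed, is given by its rows \<open>A 1, \<dots>, A m\<close>, i.e. by a function \<open>A :: nat \<Rightarrow> real ^ 'd\<close>
  restricted to \<open>{1..m}\<close>.
\<close>

definition gradient :: "(real ^ 'd \<Rightarrow> real) \<Rightarrow> real ^ 'd \<Rightarrow> real ^ 'd" where
  "gradient f x = (THE D. GDERIV f x :> D)"

definition smooth_over :: "(real ^ 'd \<Rightarrow> real) \<Rightarrow> real \<Rightarrow> (real ^ 'd) set \<Rightarrow> bool" where
  "smooth_over f \<beta> K \<longleftrightarrow>
     (\<exists>U. open U \<and> K \<subseteq> U \<and> (\<forall>x\<in>U. f differentiable (at x))) \<and>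
     (\<forall>x\<in>K. \<forall>y\<in>K. norm (gradient f x - gradient f y) \<le> \<beta> * norm (x - y))"

definition min_value :: "(real ^ 'd \<Rightarrow> real) \<Rightarrow> (real ^ 'd) set \<Rightarrow> real" where
  "min_value f K = (INF x\<in>K. f x)"

definition minimizers :: "(real ^ 'd \<Rightarrow> real) \<Rightarrow> (real ^ 'd) set \<Rightarrow> (real ^ 'd) set" where
  "minimizers f K = {x. is_arg_min f (\<lambda>y. y \<in> K) x}"

definition vertices :: "(real ^ 'd) set \<Rightarrow> (real ^ 'd) set" where
  "vertices K = {v. v extreme_point_of K}"

definition quadratic_growth :: "(real ^ 'd \<Rightarrow> real) \<Rightarrow> (real ^ 'd) set \<Rightarrow> real \<Rightarrow> bool" where
  "quadratic_growth f K \<alpha> \<longleftrightarrow>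
     (\<forall>x\<in>K. (infdist x (minimizers f K))\<^sup>2 \<le> 2 / \<alpha> * (f x - min_value f K))"

definition face_dim ::
  "nat \<Rightarrow> (nat \<Rightarrow> real ^ 'd) \<Rightarrow> nat \<Rightarrow> (nat \<Rightarrow> real ^ 'd) \<Rightarrow> (nat \<Rightarrow> real) \<Rightarrow> (real ^ 'd) set \<Rightarrow> nat"
  where
  "face_dim m1 A1 m2 A2 b2 F =
     CARD('d) - dim (span (A1 ` {1..m1} \<union> {A2 i | i. i \<in> {1..m2} \<and> (\<forall>x\<in>F. A2 i \<bullet> x = b2 i)}))"

definition lowest_dim_face_containing ::
  "nat \<Rightarrow> (nat \<Rightarrow> real ^ 'd) \<Rightarrow> nat \<Rightarrow> (nat \<Rightarrow> real ^ 'd) \<Rightarrow> (nat \<Rightarrow> real)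
     \<Rightarrow> (real ^ 'd) set \<Rightarrow> (real ^ 'd) set \<Rightarrow> (real ^ 'd) set \<Rightarrow> bool"
  where
  "lowest_dim_face_containing m1 A1 m2 A2 b2 K X F \<longleftrightarrow>
     F face_of K \<and> X \<subseteq> F \<and>
     (\<forall>G. G face_of K \<and> X \<subseteq> G \<longrightarrow> face_dim m1 A1 m2 A2 b2 F \<le> face_dim m1 A1 m2 A2 b2 G)"

text \<open>Indices of the inequality rows that are tight at some points of \<open>F\<close> but not at others.\<close>

definition partly_tight ::
  "nat \<Rightarrow> (nat \<Rightarrow> real ^ 'd) \<Rightarrow> (nat \<Rightarrow> real) \<Rightarrow> (real ^ 'd) set \<Rightarrow> nat set" where
  "partly_tight m2 A2 b2 F =
     {i \<in> {1..m2}. (\<exists>x\<in>F. A2 i \<bullet> x = b2 i) \<and> (\<exists>x\<in>F. A2 i \<bullet> x \<noteq> b2 i)}"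

text \<open>
  The operator norm of the linear map \<open>x \<mapsto> M x\<close> between Euclidean spaces, for a matrix \<open>M\<close>
  given by the list of its rows. This is \<^const>\<open>onorm\<close> unfolded, with \<^const>\<open>L2_set\<close> as the
  norm of the target space, whose dimension is not a type.
\<close>

definition spectral_norm :: "(real ^ 'd) list \<Rightarrow> real" where
  "spectral_norm M = (SUP x. L2_set (\<lambda>j. M ! j \<bullet> x) {..<length M} / norm x)"

definition independent_row_matrices :: "nat \<Rightarrow> (real ^ 'd) set \<Rightarrow> (real ^ 'd) list set" where
  "independent_row_matrices k R =
     {M. length M = k \<and> set M \<subseteq> R \<and> distinct M \<and> independent (set M)}"

definition psi ::
  "nat \<Rightarrow> (nat \<Rightarrow> real ^ 'd) \<Rightarrow> nat \<Rightarrow> (nat \<Rightarrow> real ^ 'd) \<Rightarrow> (nat \<Rightarrow> real) \<Rightarrow> (real ^ 'd) set \<Rightarrow> real"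
  where
  "psi m1 A1 m2 A2 b2 F =
     Max (spectral_norm ` independent_row_matrices (face_dim m1 A1 m2 A2 b2 F)
       (A2 ` partly_tight m2 A2 b2 F))"

definition xi ::
  "nat \<Rightarrow> (nat \<Rightarrow> real ^ 'd) \<Rightarrow> (nat \<Rightarrow> real) \<Rightarrow> (real ^ 'd) set \<Rightarrow> (real ^ 'd) set \<Rightarrow> real" where
  "xi m2 A2 b2 K F =
     Min ((\<lambda>v. Min {b2 i - A2 i \<bullet> v | i. i \<in> partly_tight m2 A2 b2 F \<and> b2 i > A2 i \<bullet> v})
       ` (vertices K \<inter> F))"

text \<open>
  If \<open>F\<close> is a point, no row is partly tight and \<^const>\<open>xi\<close> is meaningless; \<open>kappa\<close> is then \<open>0\<close>
  by convention.
\<close>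

definition kappa ::
  "nat \<Rightarrow> (nat \<Rightarrow> real ^ 'd) \<Rightarrow> nat \<Rightarrow> (nat \<Rightarrow> real ^ 'd) \<Rightarrow> (nat \<Rightarrow> real)
     \<Rightarrow> (real ^ 'd) set \<Rightarrow> (real ^ 'd) set \<Rightarrow> real \<Rightarrow> real" where
  "kappa m1 A1 m2 A2 b2 K F \<alpha> =
     (if face_dim m1 A1 m2 A2 b2 F = 0 then 0
      else let \<mu> = psi m1 A1 m2 A2 b2 F / xi m2 A2 b2 K F
           in 2 * \<mu>\<^sup>2 * real (face_dim m1 A1 m2 A2 b2 F) / \<alpha>)"

definition strict_complementarity ::
  "(real ^ 'd \<Rightarrow> real) \<Rightarrow> (real ^ 'd) set \<Rightarrow> (real ^ 'd) set \<Rightarrow> real \<Rightarrow> bool" where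
  "strict_complementarity f K F \<delta> \<longleftrightarrow>
     (\<forall>x\<in>minimizers f K. \<forall>v\<in>vertices K.
        (v \<notin> F \<longrightarrow> (v - x) \<bullet> gradient f x \<ge> \<delta>) \<and>
        (v \<in> F \<longrightarrow> (v - x) \<bullet> gradient f x = 0))"

text \<open>
  One iteration from \<open>x\<close> to \<open>x'\<close>, with an arbitrary convex decomposition of \<open>x\<close> into vertices
  \<open>v 1, \<dots>, v k\<close> and an arbitrary choice of oracle answer, option and minimizer.
\<close>

definition nep_step ::
  "(real ^ 'd \<Rightarrow> real) \<Rightarrow> (real ^ 'd) set \<Rightarrow> real \<Rightarrow> real \<Rightarrow> real ^ 'd \<Rightarrow> real ^ 'd \<Rightarrow> bool" where
  "nep_step f K \<beta> \<rho> x x' \<longleftrightarrow>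
     (\<exists>(k::nat) c v.
        (\<forall>i\<in>{1..k}. v i \<in> vertices K \<and> 0 \<le> c i) \<and> (\<Sum>i=1..k. c i) = 1 \<and>
        x = (\<Sum>i=1..k. c i *\<^sub>R v i) \<and>
        is_arg_min (\<lambda>u. u \<bullet> gradient f x + \<beta> * \<rho> * (norm (u - x))\<^sup>2)
          (\<lambda>u. u \<in> vertices K) (v (k + 1)) \<and>
        (is_arg_min (\<lambda>y. y \<bullet> gradient f x + \<beta> / 2 * (norm (y - x))\<^sup>2)
           (\<lambda>y. y \<in> convex hull (v ` {1..k + 1})) x' \<or>
         is_arg_min f (\<lambda>y. y \<in> convex hull (v ` {1..k + 1})) x'))"

definition nep_frank_wolfe ::
  "(real ^ 'd \<Rightarrow> real) \<Rightarrow> (real ^ 'd) set \<Rightarrow> real \<Rightarrow> (nat \<Rightarrow> real) \<Rightarrow> (nat \<Rightarrow> real ^ 'd) \<Rightarrow> bool" where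
  "nep_frank_wolfe f K \<beta> \<rho> x \<longleftrightarrow>
     (\<forall>t\<ge>1. 0 \<le> \<rho> t \<and> \<rho> t \<le> 1) \<and> x 1 \<in> vertices K \<and>
     (\<forall>t\<ge>1. nep_step f K \<beta> (\<rho> t) (x t) (x (t + 1)))"

definition rho_first :: "real \<Rightarrow> real \<Rightarrow> real \<Rightarrow> real \<Rightarrow> nat \<Rightarrow> real" where
  "rho_first \<kappa> \<delta> C M1 t =
     min (sqrt (2 * max (2 * \<kappa>) (1 / \<delta>) * C * exp (- (1 / (4 * M1)) * (real t - 1)))) 1 / (2 * M1)"

definition rho_second :: "real \<Rightarrow> real \<Rightarrow> real \<Rightarrow> nat \<Rightarrow> nat \<Rightarrow> real" where
  "rho_second \<kappa> \<delta> M2 \<tau> t =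
     min (2 * \<delta> * \<kappa> * exp (- ((real t - real \<tau>) / (8 * M2)))) 1 / (2 * M2)"

end

theory Submission
  imports Defs
begin

text \<open>
  Let \<open>x = \<Sum> c\<^sub>j v\<^sub>j\<close> be an iterate with gap \<open>h\<close> and let \<open>z\<close> be a nearest minimizer. By convexity and
  strict complementarity the vertices outside \<open>F\<close> carry mass at most \<open>h / \<delta>\<close>. After discarding
  them, \<open>z\<close> is reached by moving some further mass to a single point \<open>u\<close> of \<open>F\<close>; vertices outside
  \<open>F\<close> have nonnegative slacks, so discarding them only helps the constraints, and a minimal choice
  moves at most \<open>\<mu> sqrt (dim F) dist(x, z) \<le> sqrt (\<kappa> h)\<close>: every vertex that loses mass has slack at
  least \<open>\<xi>\<close> in one of at most \<open>dim F\<close> saturated constraints that are independent modulo the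
  equality constraints of \<open>F\<close>. Hence the total moved mass is at most \<open>h / \<delta> + sqrt (\<kappa> h)\<close>. Moving
  the fraction \<open>1 / (2 M)\<close> of it to the oracle vertex instead of to \<open>u\<close> gives a comparison point whose
  second order error is controlled by the diameter of \<open>F\<close> and by quadratic growth.
\<close>

section \<open>Smooth convex functions and their minimizers\<close>

text \<open>\<open>gradient\<close> is a definite description: existence comes from representing the
  derivative in the basis, uniqueness from that of the derivative.\<close>

lemma differentiable_imp_GDERIV_gradient:
  assumes "f differentiable (at x)"
  shows "GDERIV f x :> gradient f x"
proof -
  from assms obtain f' where f': "(f has_derivative f') (at x)"
    unfolding differentiable_def by blast
  then have lin: "linear f'"
    using has_derivative_linear by blast
  have "f' = (\<lambda>h. h \<bullet> (\<Sum>b\<in>Basis. f' b *\<^sub>R b))"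
  proof
    fix h
    have "f' h = f' (\<Sum>b\<in>Basis. (h \<bullet> b) *\<^sub>R b)"
      by (simp add: euclidean_representation)
    also have "\<dots> = (\<Sum>b\<in>Basis. (h \<bullet> b) * f' b)"
      by (simp add: linear_sum[OF lin] linear_cmul[OF lin])
    also have "\<dots> = h \<bullet> (\<Sum>b\<in>Basis. f' b *\<^sub>R b)"
      by (simp add: inner_sum_right mult.commute)
    finally show "f' h = h \<bullet> (\<Sum>b\<in>Basis. f' b *\<^sub>R b)" .
  qed
  then have D: "GDERIV f x :> (\<Sum>b\<in>Basis. f' b *\<^sub>R b)"
    using f' by (simp add: gderiv_def)
  moreover have "D = (\<Sum>b\<in>Basis. f' b *\<^sub>R b)" if "GDERIV f x :> D" for D
  proof -
    have "(\<lambda>h. h \<bullet> D) = (\<lambda>h. h \<bullet> (\<Sum>b\<in>Basis. f' b *\<^sub>R b))"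
      using that D unfolding gderiv_def by (rule has_derivative_unique)
    then show ?thesis
      by (metis vector_eq_ldot)
  qed
  ultimately have "gradient f x = (\<Sum>b\<in>Basis. f' b *\<^sub>R b)"
    unfolding gradient_def by (intro the_equality)
  with D show ?thesis by simp
qed

lemma smooth_over_GDERIV:
  assumes "smooth_over f \<beta> K" "x \<in> K"
  shows "GDERIV f x :> gradient f x"
  using assms unfolding smooth_over_def
  by (blast intro: differentiable_imp_GDERIV_gradient)

lemma smooth_over_continuous_on:
  assumes "smooth_over f \<beta> K"
  shows "continuous_on K f"
  using assms unfolding smooth_over_def
  by (meson continuous_at_imp_continuous_on differentiable_imp_continuous_within subsetD)

lemma smooth_over_line_derivative:
  assumes "smooth_over f \<beta> K" "x + t *\<^sub>R u \<in> K"
  shows "((\<lambda>t. f (x + t *\<^sub>R u)) has_real_derivative u \<bullet> gradient f (x + t *\<^sub>R u)) (at t within S)"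
proof -
  have "(f has_derivative (\<lambda>h. h \<bullet> gradient f (x + t *\<^sub>R u))) (at (x + t *\<^sub>R u))"
    using smooth_over_GDERIV[OF assms] by (simp add: gderiv_def)
  moreover have "((\<lambda>t. x + t *\<^sub>R u) has_derivative (\<lambda>s. s *\<^sub>R u)) (at t within S)"
    by (auto intro!: derivative_eq_intros)
  ultimately have "((\<lambda>t. f (x + t *\<^sub>R u)) has_derivative
      (\<lambda>s. (s *\<^sub>R u) \<bullet> gradient f (x + t *\<^sub>R u))) (at t within S)"
    using has_derivative_compose by blast
  then show ?thesis
    by (simp add: has_field_derivative_def mult_commute_abs)
qed

lemma smooth_over_upper_bound:
  assumes sm: "smooth_over f \<beta> K" and "convex K" "x \<in> K" "y \<in> K"
  shows "f y \<le> f x + (y - x) \<bullet> gradient f x + \<beta> / 2 * (norm (y - x))\<^sup>2"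
proof -
  define u where "u = y - x"
  have seg: "x + t *\<^sub>R u \<in> K" if "0 \<le> t" "t \<le> 1" for t
    using convexD_alt[OF \<open>convex K\<close> \<open>x \<in> K\<close> \<open>y \<in> K\<close> that]
    by (simp add: u_def algebra_simps)
  define \<phi> where "\<phi> t = f (x + t *\<^sub>R u) - t * (u \<bullet> gradient f x) - \<beta> / 2 * t\<^sup>2 * (norm u)\<^sup>2" for t
  have "\<phi> 1 \<le> \<phi> 0"
  proof (rule DERIV_nonpos_imp_nonincreasing[of 0 1 \<phi>])
    fix t :: real assume t: "0 \<le> t" "t \<le> 1"
    let ?d = "u \<bullet> gradient f (x + t *\<^sub>R u) - u \<bullet> gradient f x - \<beta> * t * (norm u)\<^sup>2"
    have "(\<phi> has_real_derivative ?d) (at t)"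
      unfolding \<phi>_def
      by (rule derivative_eq_intros smooth_over_line_derivative[OF sm seg[OF t]] refl | simp)+
    moreover have "u \<bullet> (gradient f (x + t *\<^sub>R u) - gradient f x) \<le> \<beta> * t * (norm u)\<^sup>2"
    proof -
      have "u \<bullet> (gradient f (x + t *\<^sub>R u) - gradient f x)
          \<le> norm u * norm (gradient f (x + t *\<^sub>R u) - gradient f x)"
        by (rule norm_cauchy_schwarz)
      also have "\<dots> \<le> norm u * (\<beta> * norm (x + t *\<^sub>R u - x))"
        using sm seg[OF t] \<open>x \<in> K\<close> unfolding smooth_over_def
        by (blast intro: mult_left_mono norm_ge_zero)
      finally show ?thesis
        using t by (simp add: power2_eq_square mult_ac)
    qed
    ultimately show "\<exists>y. DERIV \<phi> t :> y \<and> y \<le> 0"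
      by (intro exI[of _ ?d]) (simp add: inner_diff_right)
  qed simp
  then show ?thesis
    by (simp add: \<phi>_def u_def)
qed

text \<open>Convexity bounds the difference quotients along the segment by \<open>f y - f x\<close>,
  and their limit at 0 is the directional derivative.\<close>

lemma convex_on_above_tangent:
  assumes sm: "smooth_over f \<beta> K" and cf: "convex_on K f" and "x \<in> K" "y \<in> K"
  shows "(y - x) \<bullet> gradient f x \<le> f y - f x"
proof -
  define g where "g t = f (x + t *\<^sub>R (y - x))" for t
  have "(g has_real_derivative (y - x) \<bullet> gradient f x) (at 0)"
    unfolding g_def using smooth_over_line_derivative[OF sm, of x 0 "y - x"] \<open>x \<in> K\<close> by simp
  \<comment> \<open>Only the limit from the right is taken, since convexity controls
    \<open>g\<close> only between 0 and 1.\<close>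
  then have "((\<lambda>t. (g t - g 0) / t) \<longlongrightarrow> (y - x) \<bullet> gradient f x) (at_right 0)"
    by (simp add: DERIV_def filterlim_at_split)
  moreover have "eventually (\<lambda>t. (g t - g 0) / t \<le> f y - f x) (at_right 0)"
  proof -
    have "(g t - g 0) / t \<le> f y - f x" if "0 < t" "t < 1" for t
    proof -
      have "g t \<le> (1 - t) * f x + t * f y"
        using convex_onD[OF cf, of t x y] that \<open>x \<in> K\<close> \<open>y \<in> K\<close>
        by (simp add: g_def algebra_simps)
      then show ?thesis
        using that by (simp add: g_def divide_simps algebra_simps)
    qed
    then show ?thesis
      by (auto simp: eventually_at_right[of 0 1] intro!: exI[of _ 1])
  qed
  ultimately show ?thesis
    by (intro tendsto_upperbound) auto
qed

section \<open>Minimizers and quadratic growth\<close>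

lemma minimizers_eq:
  "minimizers f K = {x \<in> K. \<forall>y\<in>K. f x \<le> f y}"
  by (auto simp: minimizers_def is_arg_min_def not_less)

lemma minimizers_nonempty:
  assumes "compact K" "K \<noteq> {}" "continuous_on K f"
  shows "minimizers f K \<noteq> {}"
  using continuous_attains_inf[OF assms] by (auto simp: minimizers_eq)

lemma min_value_eq:
  assumes "x \<in> minimizers f K"
  shows "min_value f K = f x"
  using assms unfolding min_value_def minimizers_eq
  by (intro antisym cINF_lower cINF_greatest bdd_belowI) auto

lemma closed_minimizers:
  assumes "closed K" "continuous_on K f"
  shows "closed (minimizers f K)"
proof (cases "minimizers f K = {}")
  case False
  then obtain z where z: "z \<in> minimizers f K" by blast
  then have "minimizers f K = {x \<in> K. f x \<in> {..f z}}"
    by (auto simp: minimizers_eq intro: order_trans)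
  then show ?thesis
    using continuous_closed_preimage[OF assms(2,1) closed_atMost, of "f z"]
    by (simp add: vimage_def Int_def)
qed simp

text \<open>The set of minimizers is closed and nonempty, so the distance to it is attained.\<close>

lemma quadratic_growth_nearest_minimizer:
  assumes qg: "quadratic_growth f K \<alpha>" and "compact K" "continuous_on K f" "x \<in> K"
  obtains z where "z \<in> minimizers f K" "(norm (x - z))\<^sup>2 \<le> 2 / \<alpha> * (f x - min_value f K)"
proof -
  have "minimizers f K \<noteq> {}" "closed (minimizers f K)"
    using assms minimizers_nonempty closed_minimizers compact_imp_closed by blast+
  then obtain z where "z \<in> minimizers f K" "infdist x (minimizers f K) = dist x z"
    using infdist_attains_inf by metis
  then show thesis
    using that qg \<open>x \<in> K\<close> by (auto simp: quadratic_growth_def dist_norm)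
qed

section \<open>Spectral norms and greedy weights\<close>

lemma L2_set_rows_le_spectral_norm:
  "L2_set (\<lambda>j. M ! j \<bullet> x) {..<length M} \<le> spectral_norm M * norm x"
proof (cases "x = 0")
  case False
  \<comment> \<open>The supremum is informative only once the quotients are known to be bounded; the
    sum of the row norms is a crude bound.\<close>
  have "L2_set (\<lambda>j. M ! j \<bullet> y) {..<length M} / norm y \<le> (\<Sum>j<length M. norm (M ! j))" for y
  proof -
    have "L2_set (\<lambda>j. M ! j \<bullet> y) {..<length M} \<le> (\<Sum>j<length M. \<bar>M ! j \<bullet> y\<bar>)"
      by (rule L2_set_le_sum_abs)
    also have "\<dots> \<le> (\<Sum>j<length M. norm (M ! j) * norm y)"
      by (intro sum_mono Cauchy_Schwarz_ineq2)
    finally show ?thesis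
      by (cases "y = 0") (auto simp: divide_simps sum_distrib_right sum_nonneg)
  qed
  then have "bdd_above (range (\<lambda>y. L2_set (\<lambda>j. M ! j \<bullet> y) {..<length M} / norm y))"
    by (intro bdd_aboveI2)
  then have "L2_set (\<lambda>j. M ! j \<bullet> x) {..<length M} / norm x \<le> spectral_norm M"
    unfolding spectral_norm_def by (intro cSUP_upper) auto
  then show ?thesis
    using False by (simp add: divide_simps)
qed (simp add: L2_set_def)

text \<open>Cauchy-Schwarz against the all-ones vector; this is the origin of the factor
  \<open>dim F\<close> in \<kappa>, after squaring.\<close>

lemma sum_abs_rows_le_spectral_norm:
  assumes "distinct M"
  shows "(\<Sum>a\<in>set M. \<bar>a \<bullet> x\<bar>) \<le> sqrt (length M) * (spectral_norm M * norm x)"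
proof -
  have "(\<Sum>a\<in>set M. \<bar>a \<bullet> x\<bar>) = (\<Sum>j<length M. \<bar>1\<bar> * \<bar>M ! j \<bullet> x\<bar>)"
    using sum.reindex_bij_betw[OF bij_betw_nth[OF assms refl refl], of "\<lambda>a. \<bar>a \<bullet> x\<bar>"] by simp
  also have "\<dots> \<le> L2_set (\<lambda>_. 1) {..<length M} * L2_set (\<lambda>j. M ! j \<bullet> x) {..<length M}"
    by (rule L2_set_mult_ineq)
  also have "L2_set (\<lambda>_. 1) {..<length M} = sqrt (length M)"
    by (simp add: L2_set_def)
  finally show ?thesis
    using mult_left_mono[OF L2_set_rows_le_spectral_norm, of "sqrt (length M)" M x] by force
qed

lemma finite_independent_row_matrices:
  assumes "finite R"
  shows "finite (independent_row_matrices k R)"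
  by (rule finite_subset[OF _ finite_lists_length_eq[OF assms, of k]])
    (auto simp: independent_row_matrices_def)

text \<open>The matrix is tested on its own row \<open>a\<close>.\<close>

lemma spectral_norm_pos:
  assumes "a \<in> set M" "a \<noteq> 0"
  shows "spectral_norm M > 0"
proof -
  obtain j where j: "j < length M" "M ! j = a"
    using assms by (auto simp: in_set_conv_nth)
  have "a \<bullet> a \<le> L2_set (\<lambda>i. M ! i \<bullet> a) {..<length M}"
    using member_le_L2_set[of "{..<length M}" j "\<lambda>i. M ! i \<bullet> a"] j by simp
  also have "\<dots> \<le> spectral_norm M * norm a"
    by (rule L2_set_rows_le_spectral_norm)
  finally show ?thesis
    using assms(2) by (smt (verit) inner_gt_zero_iff mult_nonpos_nonneg norm_ge_zero)
qed

text \<open>Coordinatewise maximality is all that is needed, and it is reached by treating one index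
  at a time, without a compactness argument.\<close>

lemma greedy_maximal_weights:
  fixes c :: "'j \<Rightarrow> real" and s :: "'i \<Rightarrow> 'j \<Rightarrow> real" and r :: "'i \<Rightarrow> real"
  assumes "finite J" "finite I"
    and "\<And>j. j \<in> J \<Longrightarrow> 0 \<le> c j"
    and "\<And>i j. i \<in> I \<Longrightarrow> j \<in> J \<Longrightarrow> 0 \<le> s i j"
    and "\<And>i. i \<in> I \<Longrightarrow> 0 \<le> r i"
  obtains w where "\<And>j. j \<in> J \<Longrightarrow> 0 \<le> w j" "\<And>j. j \<in> J \<Longrightarrow> w j \<le> c j"
    "\<And>i. i \<in> I \<Longrightarrow> (\<Sum>j\<in>J. w j * s i j) \<le> r i"
    "\<And>j. j \<in> J \<Longrightarrow> w j < c j \<Longrightarrow> \<exists>i\<in>I. s i j > 0 \<and> (\<Sum>j\<in>J. w j * s i j) = r i"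
proof -
  let ?P = "\<lambda>J w. (\<forall>j\<in>J. 0 \<le> w j \<and> w j \<le> c j) \<and> (\<forall>i\<in>I. (\<Sum>j\<in>J. w j * s i j) \<le> r i) \<and>
     (\<forall>j\<in>J. w j < c j \<longrightarrow> (\<exists>i\<in>I. s i j > 0 \<and> (\<Sum>j\<in>J. w j * s i j) = r i))"
  have "\<exists>w. ?P J w"
    using \<open>finite J\<close> assms(3,4)
  proof (induction J rule: finite_induct)
    case empty
    then show ?case using assms(5) by auto
  next
    case (insert a J)
    have "\<exists>w. ?P J w"
      by (rule insert.IH) (use insert.prems in auto)
    then obtain w where "?P J w" ..
    then have w: "\<And>j. j \<in> J \<Longrightarrow> 0 \<le> w j" "\<And>j. j \<in> J \<Longrightarrow> w j \<le> c j"
      "\<And>i. i \<in> I \<Longrightarrow> (\<Sum>j\<in>J. w j * s i j) \<le> r i"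
      "\<And>j. j \<in> J \<Longrightarrow> w j < c j \<Longrightarrow> \<exists>i\<in>I. s i j > 0 \<and> (\<Sum>j\<in>J. w j * s i j) = r i"
      by blast+
    define g where "g i = r i - (\<Sum>j\<in>J. w j * s i j)" for i
    have g0: "g i \<ge> 0" if "i \<in> I" for i
      using w(3)[OF that] by (simp add: g_def)
    \<comment> \<open>The new index gets the largest weight that its cap \<open>c a\<close> and all
      residuals \<open>g i\<close> allow.\<close>
    define S where "S = insert (c a) ((\<lambda>i. g i / s i a) ` {i \<in> I. s i a > 0})"
    define e where "e = Min S"
    have fin: "finite S" "S \<noteq> {}"
      using \<open>finite I\<close> by (auto simp: S_def)
    have e0: "0 \<le> e"
      unfolding e_def using fin insert.prems(1)[of a] g0 by (auto simp: S_def)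
    have e1: "e \<le> c a"
      unfolding e_def using fin by (auto simp: S_def)
    have e2: "e * s i a \<le> g i" if "i \<in> I" for i
    proof (cases "s i a > 0")
      case True
      then have "e \<le> g i / s i a"
        unfolding e_def using fin that by (auto simp: S_def)
      then show ?thesis using True by (simp add: field_simps)
    next
      case False
      then have "s i a = 0" using insert.prems(2)[OF that, of a] by simp
      then show ?thesis using g0[OF that] by simp
    qed
    have e3: "\<exists>i\<in>I. s i a > 0 \<and> e * s i a = g i" if "e < c a"
    proof -
      have "e \<in> S" unfolding e_def using fin by (rule Min_in)
      with that have "e \<in> (\<lambda>i. g i / s i a) ` {i \<in> I. s i a > 0}"
        by (simp add: S_def)
      then obtain i where "i \<in> I" "s i a > 0" "e = g i / s i a"
        by blast
      then show ?thesis by (intro bexI[of _ i]) auto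
    qed
    let ?w = "w(a := e)"
    have sum: "(\<Sum>j\<in>insert a J. ?w j * s i j) = e * s i a + (r i - g i)" for i
    proof -
      have "(\<Sum>j\<in>J. ?w j * s i j) = (\<Sum>j\<in>J. w j * s i j)"
        using insert.hyps by (intro sum.cong) auto
      then show ?thesis using insert.hyps by (simp add: g_def)
    qed
    show ?case
    proof (intro exI[of _ ?w] conjI ballI impI)
      fix j assume j: "j \<in> insert a J" "?w j < c j"
      show "\<exists>i\<in>I. 0 < s i j \<and> (\<Sum>j\<in>insert a J. ?w j * s i j) = r i"
      proof (cases "j = a")
        case True
        then show ?thesis using e3 j sum by fastforce
      next
        case False
        then have "j \<in> J" "w j < c j" using j by auto
        from w(4)[OF this] obtain i where i: "i \<in> I" "s i j > 0" "g i = 0"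
          by (auto simp: g_def)
        \<comment> \<open>A constraint saturated earlier has residual 0, so \<open>a\<close> adds
          nothing to it and it still blocks \<open>j\<close>.\<close>
        have "e * s i a = 0"
          using e2[OF i(1)] i(3) mult_nonneg_nonneg[OF e0 insert.prems(2)[OF i(1), of a]]
          by (intro antisym) auto
        then show ?thesis using i sum by (intro bexI[of _ i]) auto
      qed
    next
      fix i assume "i \<in> I"
      then show "(\<Sum>j\<in>insert a J. ?w j * s i j) \<le> r i"
        using e2 sum by auto
    qed (use w e0 e1 insert.hyps in auto)
  qed
  then show thesis using that by blast
qed

section \<open>Faces of polytopes\<close>

locale polytope_face =
  fixes m1 m2 :: nat and A1 A2 :: "nat \<Rightarrow> real ^ 'd" and b1 b2 :: "nat \<Rightarrow> real"
    and K F :: "(real ^ 'd) set"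
  assumes K_eq: "K = {y. (\<forall>i\<in>{1..m1}. A1 i \<bullet> y = b1 i) \<and> (\<forall>i\<in>{1..m2}. A2 i \<bullet> y \<le> b2 i)}"
    and compact_K: "compact K" and face: "F face_of K" and F_nonempty: "F \<noteq> {}"
begin

text \<open>This is the row set whose dimension is subtracted in \<open>face_dim\<close>.\<close>

definition eq_rows :: "(real ^ 'd) set" where
  "eq_rows = A1 ` {1..m1} \<union> {A2 i | i. i \<in> {1..m2} \<and> (\<forall>x\<in>F. A2 i \<bullet> x = b2 i)}"

abbreviation part :: "nat set" where
  "part \<equiv> partly_tight m2 A2 b2 F"

abbreviation kdim :: nat where
  "kdim \<equiv> face_dim m1 A1 m2 A2 b2 F"

definition slack :: "nat \<Rightarrow> real ^ 'd \<Rightarrow> real" where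
  "slack i y = b2 i - A2 i \<bullet> y"

lemma polyhedron_K: "polyhedron K"
proof -
  have "K = (\<Inter>i\<in>{1..m1}. {y. A1 i \<bullet> y = b1 i}) \<inter> (\<Inter>i\<in>{1..m2}. {y. A2 i \<bullet> y \<le> b2 i})"
    by (auto simp: K_eq)
  then show ?thesis
    by (auto intro!: polyhedron_Int polyhedron_Inter polyhedron_hyperplane polyhedron_halfspace_le)
qed

lemma convex_K: "convex K"
  using polyhedron_K by (rule polyhedron_imp_convex)

lemma F_subset_K: "F \<subseteq> K"
  using face by (rule face_of_imp_subset)

lemma convex_F: "convex F"
  using face by (rule face_of_imp_convex)

lemma compact_F: "compact F"
  using convex_K compact_K face by (rule face_of_imp_compact)

lemma finite_vertices: "finite (vertices K)"
  unfolding vertices_def using polyhedron_K by (rule finite_polyhedron_extreme_points)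

lemma vertices_subset: "vertices K \<subseteq> K"
  by (auto simp: vertices_def extreme_point_of_def)

text \<open>Carries inequalities tested on vertices over to all points of \<open>F\<close>. The
  extreme points of a face are those of \<open>K\<close> that lie in it.\<close>

lemma F_eq_hull: "F = convex hull (vertices K \<inter> F)"
proof -
  have "{v. v extreme_point_of F} = vertices K \<inter> F"
    using extreme_point_of_face[OF face] by (auto simp: vertices_def)
  then show ?thesis
    using Krein_Milman_Minkowski[OF compact_F convex_F] by simp
qed

lemma slack_nonneg: "i \<in> {1..m2} \<Longrightarrow> y \<in> K \<Longrightarrow> 0 \<le> slack i y"
  by (auto simp: K_eq slack_def)

lemma part_subset: "part \<subseteq> {1..m2}"
  by (auto simp: partly_tight_def)

lemma part_eq: "part = {i \<in> {1..m2}. (\<exists>x\<in>F. slack i x = 0) \<and> (\<exists>x\<in>F. slack i x \<noteq> 0)}"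
  by (simp add: partly_tight_def slack_def eq_commute[of "b2 _"])

lemma finite_part: "finite part"
  using part_subset by (rule finite_subset) simp

section \<open>Descriptions of a face by its constraints\<close>

text \<open>The point \<open>p\<close> plays the role of a relative interior point. Slacks are
  affine and nonnegative on \<open>F\<close>, so a midpoint keeps every slack that is positive at
  one of its ends.\<close>

lemma ex_strictly_feasible:
  obtains p where "p \<in> F"
    "\<And>i y. i \<in> {1..m2} \<Longrightarrow> y \<in> F \<Longrightarrow> slack i y \<noteq> 0 \<Longrightarrow> slack i p > 0"
proof -
  have "\<exists>p\<in>F. \<forall>i\<in>I. (\<exists>y\<in>F. slack i y \<noteq> 0) \<longrightarrow> slack i p > 0" if "finite I" "I \<subseteq> {1..m2}" for I
    using that
  proof (induction I rule: finite_induct)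
    case empty
    then show ?case using F_nonempty by auto
  next
    case (insert a I)
    then obtain p where p: "p \<in> F" "\<forall>i\<in>I. (\<exists>y\<in>F. slack i y \<noteq> 0) \<longrightarrow> slack i p > 0"
      by auto
    show ?case
    proof (cases "\<exists>y\<in>F. slack a y \<noteq> 0")
      case True
      then obtain y where y: "y \<in> F" "slack a y \<noteq> 0" by blast
      let ?q = "(1/2) *\<^sub>R p + (1/2) *\<^sub>R y"
      have q: "?q \<in> F"
        using convex_F p(1) y(1) by (rule convexD) auto
      have half: "slack i ?q = (slack i p + slack i y) / 2" for i
        by (simp add: slack_def inner_add_right field_simps)
      have nn: "0 \<le> slack i p" "0 \<le> slack i y" if "i \<in> insert a I" for i
        using that insert.prems p(1) y(1) F_subset_K slack_nonneg by blast+
      have "slack a ?q > 0"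
        using nn[of a] y(2) by (simp add: half)
      moreover have "slack i ?q > 0" if "i \<in> I" "\<exists>y\<in>F. slack i y \<noteq> 0" for i
        using nn[of i] p(2) that by (fastforce simp: half)
      ultimately show ?thesis using q by blast
    qed (use p in blast)
  qed
  from this[of "{1..m2}"] show thesis
    using that by blast
qed

text \<open>The segment from \<open>y\<close> through \<open>p\<close> can be prolonged a little
  beyond \<open>p\<close> inside \<open>K\<close>; then \<open>p\<close> is interior to a segment of
  \<open>K\<close>, and the face property puts \<open>y\<close> into \<open>F\<close>.\<close>

lemma F_eq_tight: "F = {y \<in> K. \<forall>i\<in>{1..m2}. (\<forall>x\<in>F. slack i x = 0) \<longrightarrow> slack i y = 0}" (is "F = ?R")
proof
  show "F \<subseteq> ?R" using F_subset_K by auto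
  show "?R \<subseteq> F"
  proof
    fix y assume y: "y \<in> ?R"
    obtain p where p: "p \<in> F" and
      strict: "\<And>i y. i \<in> {1..m2} \<Longrightarrow> y \<in> F \<Longrightarrow> slack i y \<noteq> 0 \<Longrightarrow> slack i p > 0"
      by (rule ex_strictly_feasible) blast
    define q where "q e = p + e *\<^sub>R (p - y)" for e :: real
    have sl: "slack i (q e) = slack i p + e * (slack i p - slack i y)" for i e
      by (simp add: q_def slack_def inner_add_right inner_diff_right algebra_simps)
    have pK: "p \<in> K" using p F_subset_K by blast
    \<comment> \<open>Rows tight on all of \<open>F\<close> vanish along the whole line; the others
      are positive at \<open>p\<close> and stay so for small \<open>e\<close>.\<close>
    have "eventually (\<lambda>e. \<forall>i\<in>{1..m2}. 0 \<le> slack i (q e)) (at_right 0)"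
    proof (intro eventually_ball_finite ballI)
      fix i assume i: "i \<in> {1..m2}"
      show "eventually (\<lambda>e. 0 \<le> slack i (q e)) (at_right 0)"
      proof (cases "\<forall>x\<in>F. slack i x = 0")
        case True
        then have "slack i y = 0" "slack i p = 0" using y i p by auto
        then show ?thesis by (simp add: sl)
      next
        case False
        then have "slack i p > 0" using strict i by blast
        moreover have "((\<lambda>e. slack i (q e)) \<longlongrightarrow> slack i p + 0 * (slack i p - slack i y)) (at_right 0)"
          unfolding sl by (intro tendsto_intros)
        ultimately have "eventually (\<lambda>e. 0 < slack i (q e)) (at_right 0)"
          by (intro order_tendstoD) auto
        then show ?thesis by (rule eventually_mono) simp
      qed
    qed simp
    then have "eventually (\<lambda>e. 0 < e \<and> (\<forall>i\<in>{1..m2}. 0 \<le> slack i (q e))) (at_right 0)"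
      by (intro eventually_conj eventually_at_right_less)
    then obtain e where e: "0 < e" "\<forall>i\<in>{1..m2}. 0 \<le> slack i (q e)"
      using eventually_happens[of _ "at_right (0::real)"] by auto
    have "A1 i \<bullet> q e = b1 i" if "i \<in> {1..m1}" for i
      using that y pK by (simp add: q_def K_eq inner_add_right inner_diff_right)
    then have qK: "q e \<in> K"
      using e(2) by (simp add: K_eq slack_def)
    show "y \<in> F"
    proof (cases "y = p")
      case False
      have "p = (1 - 1 / (1 + e)) *\<^sub>R y + (1 / (1 + e)) *\<^sub>R q e"
      proof -
        have "(1 + e) *\<^sub>R ((1 - 1 / (1 + e)) *\<^sub>R y + (1 / (1 + e)) *\<^sub>R q e) = (1 + e) *\<^sub>R p"
          using e(1) by (simp add: scaleR_add_right q_def) (simp add: algebra_simps)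
        then show ?thesis using e(1) by (simp del: scaleR_add_right)
      qed
      moreover have "y \<noteq> q e"
      proof
        assume "y = q e"
        then have "(1 + e) *\<^sub>R (p - y) = 0" by (simp add: q_def algebra_simps)
        then show False using False e(1) by simp
      qed
      ultimately have "p \<in> open_segment y (q e)"
        using e(1) by (auto simp: in_segment intro!: exI[of _ "1 / (1 + e)"])
      then show ?thesis
        using face_ofD[OF face _ _ qK p] y by blast
    qed (use p in simp)
  qed
qed

text \<open>Rows that are never tight on \<open>F\<close> are redundant: they cut out of the convex set on the right
  a subset that is relatively open as well as closed.\<close>

lemma F_eq: "F = {y. (\<forall>i\<in>{1..m1}. A1 i \<bullet> y = b1 i) \<and>
    (\<forall>i\<in>{1..m2}. (\<forall>x\<in>F. slack i x = 0) \<longrightarrow> slack i y = 0) \<and> (\<forall>i\<in>part. 0 \<le> slack i y)}"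
  (is "F = ?S")
proof -
  define N where "N = {i \<in> {1..m2}. \<forall>x\<in>F. slack i x \<noteq> 0}"
  have S_alt: "?S = (\<Inter>i\<in>{1..m1}. {y. A1 i \<bullet> y = b1 i}) \<inter>
      (\<Inter>i\<in>{i \<in> {1..m2}. \<forall>x\<in>F. slack i x = 0}. {y. A2 i \<bullet> y = b2 i}) \<inter>
      (\<Inter>i\<in>part. {y. A2 i \<bullet> y \<le> b2 i})"
    by (auto simp: slack_def)
  have "convex ?S"
    unfolding S_alt by (intro convex_Int convex_INT convex_hyperplane convex_halfspace_le)
  then have conn: "connected ?S" by (rule convex_connected)
  have cover: "i \<in> part \<or> i \<in> N \<or> (\<forall>x\<in>F. slack i x = 0)" if "i \<in> {1..m2}" for i
    using that unfolding N_def part_eq by blast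
  have FS: "F \<subseteq> ?S"
  proof
    fix y assume "y \<in> F"
    moreover from this have "y \<in> K" using F_subset_K by blast
    moreover from this have "\<forall>i\<in>part. 0 \<le> slack i y"
      using part_subset slack_nonneg by blast
    ultimately show "y \<in> ?S" by (simp add: K_eq)
  qed
  \<comment> \<open>Rows in \<open>N\<close> have nonzero, hence positive, slack on
    \<open>F\<close>, so their constraints may be written as strict ones.\<close>
  have F1: "F = ?S \<inter> (\<Inter>i\<in>N. {y. A2 i \<bullet> y < b2 i})"
  proof
    have "slack i y > 0" if "i \<in> N" "y \<in> F" for i y
      using that slack_nonneg[of i y] F_subset_K by (force simp: N_def)
    then show "F \<subseteq> ?S \<inter> (\<Inter>i\<in>N. {y. A2 i \<bullet> y < b2 i})"
      using FS by (auto simp: slack_def)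
    show "?S \<inter> (\<Inter>i\<in>N. {y. A2 i \<bullet> y < b2 i}) \<subseteq> F"
    proof
      fix y assume y: "y \<in> ?S \<inter> (\<Inter>i\<in>N. {y. A2 i \<bullet> y < b2 i})"
      have "0 \<le> slack i y" if "i \<in> {1..m2}" for i
        using cover[OF that] y that by (auto simp: slack_def less_imp_le)
      then have "y \<in> K" using y by (auto simp: K_eq slack_def)
      then show "y \<in> F" using y F_eq_tight by blast
    qed
  qed
  have "open (\<Inter>i\<in>N. {y. A2 i \<bullet> y < b2 i})"
    by (intro open_INT ballI open_halfspace_lt) (simp add: N_def)
  then have "openin (top_of_set ?S) F"
    by (subst F1) (rule openin_open_Int)
  moreover have "closedin (top_of_set ?S) F"
    using compact_F FS by (intro closed_subset compact_imp_closed)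
  ultimately have "F = {} \<or> F = ?S"
    by (rule connected_clopen[THEN iffD1, OF conn, rule_format, OF conjI])
  then show ?thesis
    by (rule disjE) (rule notE[OF F_nonempty])
qed

lemma eq_rows_orthogonal:
  assumes "a \<in> eq_rows" "y \<in> F" "z \<in> F"
  shows "a \<bullet> (y - z) = 0"
  using assms F_subset_K by (auto simp: eq_rows_def K_eq inner_diff_right subset_iff)

text \<open>With a base point the equality constraints become orthogonality to
  \<open>eq_rows\<close>, which is linear and passes to spans.\<close>

lemma mem_F_iff:
  assumes "p \<in> F"
  shows "y \<in> F \<longleftrightarrow> (\<forall>a\<in>eq_rows. a \<bullet> (y - p) = 0) \<and> (\<forall>i\<in>part. 0 \<le> slack i y)" (is "_ \<longleftrightarrow> ?R")
proof
  assume "y \<in> F" 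
  then show ?R
    using eq_rows_orthogonal assms F_subset_K slack_nonneg part_subset by blast
next
  assume R: ?R
  have "A1 i \<bullet> y = b1 i" if "i \<in> {1..m1}" for i
    using R that assms F_subset_K by (auto simp: eq_rows_def K_eq inner_diff_right)
  moreover have "slack i y = 0" if "i \<in> {1..m2}" "\<forall>x\<in>F. slack i x = 0" for i
  proof -
    have "A2 i \<in> eq_rows" using that by (auto simp: eq_rows_def slack_def)
    then show ?thesis using R that assms by (auto simp: slack_def inner_diff_right)
  qed
  ultimately show "y \<in> F" using R by (subst F_eq) blast
qed

section \<open>Spanning rows and the dimension of a face\<close>

text \<open>Otherwise \<open>F\<close> would contain a whole ray, against compactness.\<close>

lemma recession_direction_zero:
  assumes "\<And>a. a \<in> eq_rows \<Longrightarrow> a \<bullet> u = 0" "\<And>i. i \<in> part \<Longrightarrow> A2 i \<bullet> u \<le> 0"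
  shows "u = 0"
proof (rule ccontr)
  assume "u \<noteq> 0"
  obtain p where p: "p \<in> F" using F_nonempty by blast
  obtain B where B: "\<And>y. y \<in> F \<Longrightarrow> norm y \<le> B"
    using compact_imp_bounded[OF compact_F] by (auto simp: bounded_iff)
  \<comment> \<open>The length makes the norm of \<open>p + t *\<^sub>R u\<close> at least
    \<open>B + 1\<close>.\<close>
  define t where "t = (B + norm p + 1) / norm u"
  have "0 \<le> B" using B[OF p] norm_ge_zero order_trans by blast
  then have t: "0 \<le> t" by (simp add: t_def)
  have "p + t *\<^sub>R u \<in> F"
  proof (subst mem_F_iff[OF p], intro conjI ballI)
    fix i assume i: "i \<in> part"
    have "t * (A2 i \<bullet> u) \<le> 0" using t assms(2)[OF i] by (rule mult_nonneg_nonpos)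
    moreover have "0 \<le> slack i p" using p i mem_F_iff by blast
    ultimately show "0 \<le> slack i (p + t *\<^sub>R u)" by (simp add: slack_def inner_add_right)
  qed (simp add: assms(1))
  then have "norm (p + t *\<^sub>R u) \<le> B" by (rule B)
  moreover have "norm (t *\<^sub>R u) \<le> norm (p + t *\<^sub>R u) + norm p"
    using norm_triangle_ineq4[of "p + t *\<^sub>R u" p] by simp
  moreover have "norm (t *\<^sub>R u) = B + norm p + 1"
    using \<open>u \<noteq> 0\<close> \<open>0 \<le> B\<close> by (simp add: t_def)
  ultimately show False by simp
qed

text \<open>A nonzero vector orthogonal to all these rows would be a recession direction of
  \<open>F\<close>.\<close>

lemma span_rows: "span (eq_rows \<union> A2 ` part) = UNIV"
proof (rule ccontr)
  assume "span (eq_rows \<union> A2 ` part) \<noteq> UNIV"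
  then obtain u where u: "u \<noteq> 0" "\<forall>a\<in>span (eq_rows \<union> A2 ` part). u \<bullet> a = 0"
    using span_not_UNIV_orthogonal by blast
  then have "a \<bullet> u = 0" if "a \<in> eq_rows \<union> A2 ` part" for a
    using that span_base by (metis inner_commute)
  then have "u = 0"
    by (intro recession_direction_zero) auto
  with u show False by simp
qed

text \<open>Independence is needed modulo the equality rows; this is what bounds the number of rows
  by the dimension of the face.\<close>

lemma ex_row_matrix:
  assumes "T \<subseteq> part"
  obtains M B where "M \<in> independent_row_matrices kdim (A2 ` part)"
    "B \<subseteq> set M" "B \<subseteq> A2 ` T" "A2 ` T \<subseteq> span (eq_rows \<union> B)"
proof -
  \<comment> \<open>Nested independent sets: \<open>E\<close> is a basis of the equality rows,
    \<open>B1\<close> adds rows from \<open>T\<close>, and \<open>B2\<close> adds further partly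
    tight rows up to a basis of the whole space. Then \<open>B2 - E\<close> has \<open>kdim\<close>
    elements and becomes \<open>M\<close>, while \<open>B1 - E\<close> becomes
    \<open>B\<close>.\<close>
  obtain E where E: "E \<subseteq> eq_rows" "independent E" "eq_rows \<subseteq> span E" "card E = dim eq_rows"
    using basis_exists[of eq_rows] by blast
  obtain B1 where B1: "E \<subseteq> B1" "B1 \<subseteq> E \<union> A2 ` T" "independent B1" "E \<union> A2 ` T \<subseteq> span B1"
    by (rule maximal_independent_subset_extend[OF Un_upper1 E(2)])
  have B1_part: "B1 \<subseteq> E \<union> A2 ` part"
    using B1(2) assms by blast
  obtain B2 where B2: "B1 \<subseteq> B2" "B2 \<subseteq> E \<union> A2 ` part" "independent B2" "E \<union> A2 ` part \<subseteq> span B2"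
    by (rule maximal_independent_subset_extend[OF B1_part B1(3)])
  have "eq_rows \<subseteq> span B2"
    using E(3) span_mono[of E B2] B1(1) B2(1) by blast
  then have "span (eq_rows \<union> A2 ` part) \<subseteq> span B2"
    using B2(4) by (intro span_minimal) auto
  then have sp: "span B2 = UNIV" using span_rows by auto
  have finB2: "finite B2" using B2(3) by (rule independent_imp_finite)
  have "card B2 = CARD('d)"
    using basis_card_eq_dim[of B2 UNIV] sp B2(3) by simp
  moreover have "card (B2 - E) = card B2 - card E"
    using B1(1) B2(1) by (intro card_Diff_subset finite_subset[OF _ finB2]) auto
  ultimately have card: "card (B2 - E) = kdim"
    by (simp add: face_dim_def E(4) eq_rows_def)
  obtain M where M: "set M = B2 - E" "distinct M"
    using finite_distinct_list[of "B2 - E"] finB2 by auto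
  have "M \<in> independent_row_matrices kdim (A2 ` part)"
    using M card distinct_card[OF M(2)] B2(2,3) independent_mono[of B2 "B2 - E"]
    by (auto simp: independent_row_matrices_def)
  moreover have "span B1 \<subseteq> span (eq_rows \<union> (B1 - E))"
    using E(1) by (intro span_mono) auto
  ultimately show thesis
    using B1(2,4) B2(1) M(1) by (intro that[of M "B1 - E"]) blast+
qed

lemma spectral_norm_le_psi:
  "M \<in> independent_row_matrices kdim (A2 ` part) \<Longrightarrow> spectral_norm M \<le> psi m1 A1 m2 A2 b2 F"
  unfolding psi_def by (intro Max_ge finite_imageI finite_independent_row_matrices finite_part) auto

lemma psi_pos:
  assumes "kdim > 0"
  shows "psi m1 A1 m2 A2 b2 F > 0"
proof -
  \<comment> \<open>The empty \<open>T\<close> suffices, as any admissible matrix will do.\<close>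
  obtain M where M: "M \<in> independent_row_matrices kdim (A2 ` part)"
    using ex_row_matrix[of "{}"] by auto
  then have "M \<noteq> []" "independent (set M)"
    using assms by (auto simp: independent_row_matrices_def)
  then obtain a where "a \<in> set M" "a \<noteq> 0"
    by (metis dependent_zero list.set_sel(1))
  then have "0 < spectral_norm M" by (rule spectral_norm_pos)
  then show ?thesis using spectral_norm_le_psi[OF M] by simp
qed

text \<open>Both sides say that \<open>F\<close> is a point, so the convention in
  \<open>kappa\<close> applies exactly when \<open>xi\<close> has no row to range over.\<close>

lemma kdim_zero_iff: "kdim = 0 \<longleftrightarrow> part = {}"
proof
  assume "kdim = 0"
  \<comment> \<open>Subtraction of naturals yields only this inequality; the converse is the general
    bound on dimensions.\<close>
  then have "CARD('d) \<le> dim eq_rows"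
    by (simp add: face_dim_def eq_rows_def)
  then have "dim eq_rows = DIM(real ^ 'd)"
    using dim_subset_UNIV[of eq_rows] by simp
  then have sp: "span eq_rows = UNIV"
    by (simp only: dim_eq_full)
  have "y = z" if "y \<in> F" "z \<in> F" for y z
  proof -
    have "a \<bullet> (y - z) = 0" if "a \<in> span eq_rows" for a
      using that subspace_hyperplane2[of "y - z"] eq_rows_orthogonal[OF _ \<open>y \<in> F\<close> \<open>z \<in> F\<close>]
      by (rule span_induct)
    from this[of "y - z"] have "(y - z) \<bullet> (y - z) = 0"
      using sp by simp
    then show ?thesis by simp
  qed
  then show "part = {}" by (auto simp: partly_tight_def)
next
  assume "part = {}"
  then have "span eq_rows = UNIV" using span_rows by simp
  then have "dim eq_rows = CARD('d)" by (metis dim_UNIV dim_span DIM_cart DIM_real mult.right_neutral)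
  then show "kdim = 0" by (simp add: face_dim_def eq_rows_def)
qed

text \<open>Makes the inner minimum in \<open>xi\<close> range over a nonempty set. If all partly
  tight rows were tight at \<open>v\<close>, every \<open>y - v\<close> would be a recession
  direction and \<open>F\<close> would be the point \<open>v\<close>.\<close>

lemma ex_slack_vertex:
  assumes "part \<noteq> {}" "v \<in> F"
  shows "\<exists>i\<in>part. slack i v > 0"
proof (rule ccontr)
  assume "\<not> ?thesis"
  then have tight: "A2 i \<bullet> v \<ge> b2 i" if "i \<in> part" for i
    using that by (force simp: slack_def)
  have "y = v" if y: "y \<in> F" for y
  proof -
    have "y - v = 0"
    proof (rule recession_direction_zero)
      fix i assume i: "i \<in> part"
      then have "A2 i \<bullet> y \<le> b2 i" using y mem_F_iff[OF y] by (auto simp: slack_def)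
      then show "A2 i \<bullet> (y - v) \<le> 0" using tight[OF i] by (simp add: inner_diff_right)
    qed (simp add: eq_rows_orthogonal y assms)
    then show ?thesis by simp
  qed
  then have "part = {}" by (auto simp: partly_tight_def)
  with assms(1) show False by simp
qed

lemma vertices_F_nonempty: "vertices K \<inter> F \<noteq> {}"
  using F_eq_hull F_nonempty by (metis convex_hull_empty)

lemma xi_eq:
  "xi m2 A2 b2 K F = Min ((\<lambda>v. Min ((\<lambda>i. slack i v) ` {i \<in> part. slack i v > 0})) ` (vertices K \<inter> F))"
proof -
  have "{b2 i - A2 i \<bullet> v | i. i \<in> part \<and> b2 i > A2 i \<bullet> v} = (\<lambda>i. slack i v) ` {i \<in> part. slack i v > 0}" for v
    by (auto simp: slack_def)
  then show ?thesis by (simp add: xi_def)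
qed

lemma xi_le:
  assumes "v \<in> vertices K \<inter> F" "i \<in> part" "slack i v > 0"
  shows "xi m2 A2 b2 K F \<le> slack i v"
proof -
  have "xi m2 A2 b2 K F \<le> Min ((\<lambda>i. slack i v) ` {i \<in> part. slack i v > 0})"
    unfolding xi_eq using finite_vertices assms(1) by (intro Min_le) auto
  also have "\<dots> \<le> slack i v"
    using finite_part assms by (intro Min_le) auto
  finally show ?thesis .
qed

lemma xi_pos:
  assumes "part \<noteq> {}"
  shows "xi m2 A2 b2 K F > 0"
proof -
  have "0 < Min ((\<lambda>i. slack i v) ` {i \<in> part. slack i v > 0})" if "v \<in> vertices K \<inter> F" for v
    using finite_part ex_slack_vertex[OF assms, of v] that by (subst Min_gr_iff) auto
  then show ?thesis
    unfolding xi_eq using finite_vertices vertices_F_nonempty by (subst Min_gr_iff) auto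
qed

section \<open>Transport of mass to a point of the face\<close>

text \<open>Vertices in \<open>F\<close> keep a maximal mass \<open>w\<close> whose slacks do not
  exceed those of \<open>z\<close>; all remaining mass moves to \<open>u\<close>. It consists of the
  mass \<open>out\<close> outside \<open>F\<close> and the mass \<open>R\<close> taken from vertices
  in \<open>F\<close>. Each unit of \<open>R\<close> carries slack at least \<open>xi\<close> in the
  rows of \<open>B\<close>, and the total slack lost there is controlled by
  \<open>z - x\<close>.\<close>

lemma transport_to_face:
  fixes v :: "'j \<Rightarrow> real ^ 'd"
  assumes J: "finite J" "\<And>j. j \<in> J \<Longrightarrow> v j \<in> vertices K" "\<And>j. j \<in> J \<Longrightarrow> 0 \<le> c j" "sum c J = 1"
    and x: "x = (\<Sum>j\<in>J. c j *\<^sub>R v j)" and z: "z \<in> F"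
  obtains p u where "\<And>j. j \<in> J \<Longrightarrow> 0 \<le> p j" "\<And>j. j \<in> J \<Longrightarrow> p j \<le> c j" "u \<in> F"
    "z - x = (\<Sum>j\<in>J. p j *\<^sub>R (u - v j))"
    "sum p J \<le> sum c {j \<in> J. v j \<notin> F} +
       (if kdim = 0 then 0 else sqrt kdim * (psi m1 A1 m2 A2 b2 F / xi m2 A2 b2 K F) * norm (z - x))"
proof -
  define J1 where "J1 = {j \<in> J. v j \<in> F}"
  have J1: "finite J1" "J1 \<subseteq> J" and vF: "\<And>j. j \<in> J1 \<Longrightarrow> v j \<in> vertices K \<inter> F"
    using J by (auto simp: J1_def)
  have vK: "v j \<in> K" if "j \<in> J" for j
    using J(2)[OF that] vertices_subset by blast
  have sl: "0 \<le> slack i (v j)" if "i \<in> part" "j \<in> J" for i j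
    using that vK part_subset slack_nonneg by blast
  have zs: "0 \<le> slack i z" if "i \<in> part" for i
    using that z F_subset_K part_subset slack_nonneg by blast
  obtain w where w: "\<And>j. j \<in> J1 \<Longrightarrow> 0 \<le> w j" "\<And>j. j \<in> J1 \<Longrightarrow> w j \<le> c j"
    "\<And>i. i \<in> part \<Longrightarrow> (\<Sum>j\<in>J1. w j * slack i (v j)) \<le> slack i z"
    "\<And>j. j \<in> J1 \<Longrightarrow> w j < c j \<Longrightarrow>
       \<exists>i\<in>part. slack i (v j) > 0 \<and> (\<Sum>j\<in>J1. w j * slack i (v j)) = slack i z"
    by (rule greedy_maximal_weights[OF J1(1) finite_part, of c "\<lambda>i j. slack i (v j)" "\<lambda>i. slack i z"])
      (blast intro: J(3) sl zs J1(2)[THEN subsetD])+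
  define P where "P = (\<Sum>j\<in>J1. w j *\<^sub>R v j)"
  define D where "D = 1 - sum w J1"
  define out where "out = sum c {j \<in> J. v j \<notin> F}"
  define R where "R = (\<Sum>j\<in>J1. c j - w j)"
  have "sum c J = out + sum c J1"
    unfolding out_def J1_def using sum.Int_Diff[OF J(1), of c "{j. v j \<in> F}"]
    by (simp add: Int_def set_diff_eq)
  then have D: "D = out + R"
    using J(4) by (simp add: D_def R_def sum_subtractf)
  have out: "0 \<le> out" unfolding out_def using J(3) by (intro sum_nonneg) auto
  have R: "0 \<le> R" unfolding R_def using w(2) by (intro sum_nonneg) auto
  have eqP: "a \<bullet> (z - P - D *\<^sub>R z) = 0" if "a \<in> eq_rows" for a
  proof -
    have "a \<bullet> (v j - z) = 0" if "j \<in> J1" for j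
      using eq_rows_orthogonal[OF \<open>a \<in> eq_rows\<close>] vF[OF that] z by blast
    then have "(\<Sum>j\<in>J1. w j * (a \<bullet> (v j - z))) = 0"
      by (intro sum.neutral) simp
    then have "a \<bullet> P = sum w J1 * (a \<bullet> z)"
      by (simp add: P_def inner_sum_right inner_diff_right right_diff_distrib sum_subtractf sum_distrib_right)
    then show ?thesis
      by (simp add: D_def inner_diff_right algebra_simps)
  qed
  have slP: "(\<Sum>j\<in>J1. w j * slack i (v j)) = b2 i - D * b2 i - A2 i \<bullet> P" for i
    by (simp add: slack_def D_def P_def inner_sum_right right_diff_distrib sum_subtractf
        flip: sum_distrib_right) (simp add: algebra_simps)
  \<comment> \<open>If mass remains, \<open>u\<close> is forced to be the rest of \<open>z\<close>
    divided by \<open>D\<close>, and the choice of \<open>w\<close> leaves it nonnegative slacks. If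
    none remains, \<open>z = P\<close> by compactness, and any point of \<open>F\<close>
    serves.\<close>
  obtain u where u: "u \<in> F" "z = P + D *\<^sub>R u"
  proof (cases "D = 0")
    case True
    have "z - P = 0"
    proof (rule recession_direction_zero)
      show "a \<bullet> (z - P) = 0" if "a \<in> eq_rows" for a
        using eqP[OF that] True by simp
      show "A2 i \<bullet> (z - P) \<le> 0" if "i \<in> part" for i
        using w(3)[OF that] unfolding slP by (simp add: True slack_def inner_diff_right)
    qed
    then show ?thesis using that[OF z] True by simp
  next
    case False
    then have D0: "D > 0" using D out R by simp
    define u where "u = (1 / D) *\<^sub>R (z - P)"
    have zu: "z = P + D *\<^sub>R u" using D0 by (simp add: u_def)
    have "u \<in> F"
    proof (subst mem_F_iff[OF z], intro conjI ballI)
      fix a assume "a \<in> eq_rows"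
      have "D * (a \<bullet> (u - z)) = a \<bullet> (z - P - D *\<^sub>R z)"
        using D0 by (simp add: u_def inner_diff_right algebra_simps)
      then show "a \<bullet> (u - z) = 0" using eqP[OF \<open>a \<in> eq_rows\<close>] D0 by simp
    next
      fix i assume "i \<in> part"
      have "D * slack i u = slack i z - (\<Sum>j\<in>J1. w j * slack i (v j))"
        unfolding slP using D0 by (simp add: u_def slack_def inner_diff_right algebra_simps)
      then have "0 \<le> D * slack i u" using w(3)[OF \<open>i \<in> part\<close>] by simp
      then show "0 \<le> slack i u" using D0 by (simp add: zero_le_mult_iff)
    qed
    then show ?thesis using that zu by blast
  qed
  have Dslack: "D * slack i u = slack i z - (\<Sum>j\<in>J1. w j * slack i (v j))" for i
  proof -
    have "A2 i \<bullet> z = A2 i \<bullet> P + D * (A2 i \<bullet> u)"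
      using arg_cong[OF u(2), of "\<lambda>y. A2 i \<bullet> y"] by (simp only: inner_add_right inner_scaleR_right)
    then show ?thesis
      unfolding slP by (simp add: slack_def right_diff_distrib)
  qed
  define bound where "bound = (if kdim = 0 then 0
    else sqrt kdim * (psi m1 A1 m2 A2 b2 F / xi m2 A2 b2 K F) * norm (z - x))"
  have "R \<le> bound"
  proof (cases "kdim = 0")
    case True
    then have part: "part = {}" by (simp only: kdim_zero_iff not_False_eq_True)
    \<comment> \<open>Without partly tight rows nothing blocks a vertex of \<open>F\<close>, so all
      of them keep their full mass.\<close>
    have "w j = c j" if "j \<in> J1" for j
    proof -
      have "\<not> w j < c j" using w(4)[OF that] unfolding part by blast
      then show ?thesis using w(2)[OF that] by simp
    qed
    then show ?thesis using True by (simp add: R_def bound_def)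
  next
    case False
    then have part: "part \<noteq> {}" by (simp only: kdim_zero_iff not_False_eq_True)
    note psi = psi_pos[OF False[THEN neq0_conv[THEN iffD1]]] and xi = xi_pos[OF part]
    show ?thesis
    proof (cases "D = 0")
      case True
      then have "R = 0" using D out R by simp
      then show ?thesis using psi xi False by (simp add: bound_def)
    next
      case D0: False
      \<comment> \<open>These are the saturated rows; as \<open>D\<close> is nonzero, they are tight
        at \<open>u\<close>.\<close>
      define T where "T = {i \<in> part. (\<Sum>j\<in>J1. w j * slack i (v j)) = slack i z}"
      have slT: "slack i u = 0" if "i \<in> T" for i
        using Dslack[of i] that D0 by (simp add: T_def)
      have "T \<subseteq> part" by (auto simp: T_def)
      then obtain M B where M: "M \<in> independent_row_matrices kdim (A2 ` part)"
        and B: "B \<subseteq> set M" "B \<subseteq> A2 ` T" "A2 ` T \<subseteq> span (eq_rows \<union> B)"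
        by (rule ex_row_matrix)
      have finB: "finite B" using B(1) finite_subset by blast
      define idx where "idx b = (SOME i. i \<in> T \<and> A2 i = b)" for b
      have idx: "idx b \<in> T" "A2 (idx b) = b" if "b \<in> B" for b
      proof -
        have "\<exists>i. i \<in> T \<and> A2 i = b" using that B(2) by blast
        then have "idx b \<in> T \<and> A2 (idx b) = b" unfolding idx_def by (rule someI_ex)
        then show "idx b \<in> T" "A2 (idx b) = b" by auto
      qed
      have idx_part: "idx b \<in> part" if "b \<in> B" for b
        using idx(1)[OF that] by (simp add: T_def)
      \<comment> \<open>The few rows of \<open>B\<close> detect every vertex that loses mass: if all
        were tight at \<open>v j\<close>, then \<open>v j - u\<close> would be orthogonal to
        \<open>eq_rows\<close> and \<open>B\<close>, hence to every row of \<open>T\<close>, so the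
        row of \<open>T\<close> that blocks \<open>v j\<close> would be tight there too.\<close>
      have "\<exists>b\<in>B. slack (idx b) (v j) > 0" if j: "j \<in> J1" "w j < c j" for j
      proof (rule ccontr)
        assume no: "\<not> ?thesis"
        have orth: "a \<bullet> (v j - u) = 0" if "a \<in> eq_rows \<union> B" for a
        proof (cases "a \<in> eq_rows")
          case True
          then show ?thesis using eq_rows_orthogonal vF[OF j(1)] u(1) by blast
        next
          case False
          then have a: "a \<in> B" using that by blast
          then have "slack (idx a) (v j) = 0"
            using no sl[OF idx_part[OF a]] j(1) J1(2) by (metis less_eq_real_def subsetD)
          moreover have "slack (idx a) u = 0" using slT idx(1)[OF a] .
          ultimately show ?thesis using idx(2)[OF a] by (simp add: slack_def inner_diff_right)
        qed
        have "a \<bullet> (v j - u) = 0" if "a \<in> span (eq_rows \<union> B)" for a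
          using that subspace_hyperplane2[of "v j - u"] orth
          by (rule span_induct) auto
        then have "A2 i \<bullet> (v j - u) = 0" if "i \<in> T" for i
          using B(3) that by blast
        then have "slack i (v j) = 0" if "i \<in> T" for i
          using slT[OF that] that by (simp add: slack_def inner_diff_right)
        moreover obtain i where "i \<in> T" "slack i (v j) > 0"
          using w(4)[OF j] by (auto simp: T_def)
        ultimately show False by force
      qed
      then have big: "xi m2 A2 b2 K F \<le> (\<Sum>b\<in>B. slack (idx b) (v j))" if j: "j \<in> J1" "w j < c j" for j
      proof -
        from \<open>\<And>j. j \<in> J1 \<Longrightarrow> w j < c j \<Longrightarrow> \<exists>b\<in>B. slack (idx b) (v j) > 0\<close>[OF j]
        obtain b where b: "b \<in> B" "slack (idx b) (v j) > 0" by blast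
        have "xi m2 A2 b2 K F \<le> slack (idx b) (v j)"
          using xi_le[OF vF[OF j(1)] idx_part[OF b(1)] b(2)] .
        also have "\<dots> \<le> (\<Sum>b\<in>B. slack (idx b) (v j))"
          using finB b(1) sl[OF idx_part] j(1) J1(2) by (intro member_le_sum) auto
        finally show ?thesis .
      qed
      have "R * xi m2 A2 b2 K F = (\<Sum>j\<in>J1. (c j - w j) * xi m2 A2 b2 K F)"
        by (simp add: R_def sum_distrib_right)
      also have "\<dots> \<le> (\<Sum>j\<in>J1. (c j - w j) * (\<Sum>b\<in>B. slack (idx b) (v j)))"
      proof (rule sum_mono)
        fix j assume j: "j \<in> J1"
        show "(c j - w j) * xi m2 A2 b2 K F \<le> (c j - w j) * (\<Sum>b\<in>B. slack (idx b) (v j))"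
          using big[OF j] w(2)[OF j] by (cases "w j < c j") (auto intro: mult_left_mono)
      qed
      also have "\<dots> = (\<Sum>b\<in>B. \<Sum>j\<in>J1. (c j - w j) * slack (idx b) (v j))"
        by (simp add: sum_distrib_left) (rule sum.swap)
      also have "\<dots> \<le> (\<Sum>b\<in>B. \<bar>b \<bullet> (z - x)\<bar>)"
      proof (rule sum_mono)
        fix b assume b: "b \<in> B"
        let ?i = "idx b"
        have "(\<Sum>j\<in>J1. (c j - w j) * slack ?i (v j)) = (\<Sum>j\<in>J1. c j * slack ?i (v j)) - slack ?i z"
          using idx(1)[OF b] by (simp add: T_def left_diff_distrib sum_subtractf)
        \<comment> \<open>Vertices outside \<open>F\<close> have nonnegative slacks, so they may be
          added.\<close>
        also have "(\<Sum>j\<in>J1. c j * slack ?i (v j)) \<le> (\<Sum>j\<in>J. c j * slack ?i (v j))"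
          using J J1 sl[OF idx_part[OF b]] by (intro sum_mono2) auto
        also have "(\<Sum>j\<in>J. c j * slack ?i (v j)) = slack ?i x"
          using J(4) by (simp add: slack_def x inner_sum_right right_diff_distrib sum_subtractf
              flip: sum_distrib_right)
        also have "slack ?i x - slack ?i z = b \<bullet> (z - x)"
          using idx(2)[OF b] by (simp add: slack_def inner_diff_right)
        finally show "(\<Sum>j\<in>J1. (c j - w j) * slack ?i (v j)) \<le> \<bar>b \<bullet> (z - x)\<bar>" by simp
      qed
      \<comment> \<open>The rows of \<open>B\<close> are completed to the full matrix
        \<open>M\<close>, to which \<open>psi\<close> applies.\<close>
      also have "\<dots> \<le> (\<Sum>b\<in>set M. \<bar>b \<bullet> (z - x)\<bar>)"
        using B(1) by (intro sum_mono2) auto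
      also have "\<dots> \<le> sqrt (length M) * (spectral_norm M * norm (z - x))"
        using M by (intro sum_abs_rows_le_spectral_norm) (simp add: independent_row_matrices_def)
      also have "\<dots> \<le> sqrt kdim * (psi m1 A1 m2 A2 b2 F * norm (z - x))"
        using M spectral_norm_le_psi[OF M]
        by (simp add: independent_row_matrices_def mult_left_mono mult_right_mono)
      finally show ?thesis
        using xi False by (simp add: bound_def field_simps)
    qed
  qed
  define p where "p j = (if v j \<in> F then c j - w j else c j)" for j
  have split: "J = J1 \<union> {j \<in> J. v j \<notin> F}" "J1 \<inter> {j \<in> J. v j \<notin> F} = {}"
    by (auto simp: J1_def)
  have pD: "sum p J = D"
  proof -
    have "sum p J = sum p J1 + sum p {j \<in> J. v j \<notin> F}"
      using J(1) J1(1) split by (metis finite_Un sum.union_disjoint)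
    also have "sum p J1 = R" unfolding R_def by (rule sum.cong) (auto simp: p_def J1_def)
    also have "sum p {j \<in> J. v j \<notin> F} = out" unfolding out_def by (rule sum.cong) (auto simp: p_def)
    finally show ?thesis using D by simp
  qed
  have "(\<Sum>j\<in>J. (c j - p j) *\<^sub>R v j) = P"
    unfolding P_def
    by (rule sum.mono_neutral_cong_right) (use J in \<open>auto simp: p_def J1_def\<close>)
  then have "P = x - (\<Sum>j\<in>J. p j *\<^sub>R v j)"
    by (simp add: x scaleR_diff_left sum_subtractf)
  moreover have "(\<Sum>j\<in>J. p j *\<^sub>R (u - v j)) = D *\<^sub>R u - (\<Sum>j\<in>J. p j *\<^sub>R v j)"
    by (simp add: scaleR_diff_right sum_subtractf pD flip: scaleR_left.sum)
  ultimately have "z - x = (\<Sum>j\<in>J. p j *\<^sub>R (u - v j))"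
    using arg_cong[OF u(2), of "\<lambda>y. y - x"] by (simp only:) simp
  moreover have "0 \<le> p j" "p j \<le> c j" if "j \<in> J" for j
    using that w(1,2)[of j] J(3)[OF that] by (auto simp: p_def J1_def)
  moreover have "sum p J \<le> out + bound" using pD D \<open>R \<le> bound\<close> by simp
  ultimately show thesis
    using that[of p u] u(1) by (auto simp: out_def bound_def)
qed

end

section \<open>Convergence of the algorithm\<close>

locale nep_setting = polytope_face m1 m2 A1 A2 b1 b2 K F
  for m1 m2 :: nat and A1 A2 :: "nat \<Rightarrow> real ^ 'd" and b1 b2 :: "nat \<Rightarrow> real"
    and K F :: "(real ^ 'd) set" +
  fixes f :: "real ^ 'd \<Rightarrow> real" and \<alpha> \<beta> \<delta> :: real
  assumes cvx: "convex_on K f" and \<beta>: "\<beta> > 0" and smooth: "smooth_over f \<beta> K"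
    and \<alpha>: "\<alpha> > 0" and growth: "quadratic_growth f K \<alpha>"
    and min_F: "minimizers f K \<subseteq> F" and \<delta>: "\<delta> > 0" and sc: "strict_complementarity f K F \<delta>"
begin

abbreviation \<kappa> :: real where
  "\<kappa> \<equiv> kappa m1 A1 m2 A2 b2 K F \<alpha>"

abbreviation gap :: "real ^ 'd \<Rightarrow> real" where
  "gap y \<equiv> f y - min_value f K"

lemma K_nonempty: "K \<noteq> {}"
  using F_subset_K F_nonempty by blast

lemma gap_nonneg: "y \<in> K \<Longrightarrow> 0 \<le> gap y"
  using minimizers_nonempty[OF compact_K K_nonempty smooth_over_continuous_on[OF smooth]]
    min_value_eq[of _ f K] by (auto simp: minimizers_eq)

lemma kappa_nonneg: "0 \<le> \<kappa>"
  using \<alpha> by (simp add: kappa_def Let_def)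

lemma kappa_pos: "kdim > 0 \<Longrightarrow> 0 < \<kappa>"
  using \<alpha> psi_pos xi_pos kdim_zero_iff by (simp add: kappa_def Let_def)

text \<open>Strict complementarity bounds the mass outside \<open>F\<close>, and quadratic growth
  turns the distance to \<open>z\<close> into the square root term.\<close>

lemma transport_to_minimizer:
  fixes v :: "'j \<Rightarrow> real ^ 'd"
  assumes J: "finite J" "\<And>j. j \<in> J \<Longrightarrow> v j \<in> vertices K" "\<And>j. j \<in> J \<Longrightarrow> 0 \<le> c j" "sum c J = 1"
    and x: "x = (\<Sum>j\<in>J. c j *\<^sub>R v j)"
  obtains z p u where "z \<in> minimizers f K" "(norm (z - x))\<^sup>2 \<le> 2 / \<alpha> * gap x"
    "\<And>j. j \<in> J \<Longrightarrow> 0 \<le> p j" "\<And>j. j \<in> J \<Longrightarrow> p j \<le> c j" "u \<in> F"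
    "z - x = (\<Sum>j\<in>J. p j *\<^sub>R (u - v j))"
    "sum p J \<le> gap x / \<delta> + sqrt (\<kappa> * gap x)"
proof -
  have xK: "x \<in> K"
    unfolding x using J vertices_subset by (intro convex_sum convex_K) auto
  obtain z where z: "z \<in> minimizers f K" and dist: "(norm (z - x))\<^sup>2 \<le> 2 / \<alpha> * gap x"
    using quadratic_growth_nearest_minimizer[OF growth compact_K smooth_over_continuous_on[OF smooth] xK]
    by (metis norm_minus_commute)
  have zF: "z \<in> F" and zK: "z \<in> K" using z min_F F_subset_K by auto
  obtain p u where p: "\<And>j. j \<in> J \<Longrightarrow> 0 \<le> p j" "\<And>j. j \<in> J \<Longrightarrow> p j \<le> c j" "u \<in> F"
    "z - x = (\<Sum>j\<in>J. p j *\<^sub>R (u - v j))" and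
    le: "sum p J \<le> sum c {j \<in> J. v j \<notin> F} +
       (if kdim = 0 then 0 else sqrt kdim * (psi m1 A1 m2 A2 b2 F / xi m2 A2 b2 K F) * norm (z - x))"
    using transport_to_face[OF J x zF] by blast
  have "\<delta> * sum c {j \<in> J. v j \<notin> F} \<le> gap x"
  proof -
    \<comment> \<open>Against the gradient at \<open>z\<close>, vertices outside \<open>F\<close>
      contribute at least \<delta> per unit of mass and those in \<open>F\<close> nothing; by
      convexity the total is at most the gap.\<close>
    let ?g = "gradient f z"
    have "\<delta> * sum c {j \<in> J. v j \<notin> F} = (\<Sum>j\<in>{j \<in> J. v j \<notin> F}. c j * \<delta>)"
      by (simp add: sum_distrib_left mult.commute)
    also have "\<dots> \<le> (\<Sum>j\<in>{j \<in> J. v j \<notin> F}. c j * ((v j - z) \<bullet> ?g))"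
      using sc z J by (intro sum_mono mult_left_mono) (auto simp: strict_complementarity_def)
    also have "\<dots> = (\<Sum>j\<in>J. c j * ((v j - z) \<bullet> ?g))"
      using sc z J by (intro sum.mono_neutral_left) (auto simp: strict_complementarity_def)
    also have "\<dots> = (\<Sum>j\<in>J. c j *\<^sub>R (v j - z)) \<bullet> ?g"
      by (simp add: inner_sum_left)
    also have "(\<Sum>j\<in>J. c j *\<^sub>R (v j - z)) = x - z"
      using J(4) by (simp add: x scaleR_diff_right sum_subtractf flip: scaleR_left.sum)
    also have "(x - z) \<bullet> ?g \<le> f x - f z"
      by (rule convex_on_above_tangent[OF smooth cvx zK xK])
    finally show ?thesis by (simp add: min_value_eq[OF z])
  qed
  then have "sum c {j \<in> J. v j \<notin> F} \<le> gap x / \<delta>"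
    using \<delta> by (simp add: field_simps)
  moreover have "sqrt kdim * (psi m1 A1 m2 A2 b2 F / xi m2 A2 b2 K F) * norm (z - x) \<le> sqrt (\<kappa> * gap x)"
    if "kdim \<noteq> 0"
  proof (rule real_le_rsqrt)
    let ?\<mu> = "psi m1 A1 m2 A2 b2 F / xi m2 A2 b2 K F"
    have "(sqrt kdim * ?\<mu> * norm (z - x))\<^sup>2 = kdim * ?\<mu>\<^sup>2 * (norm (z - x))\<^sup>2"
      by (simp only: power_mult_distrib real_sqrt_pow2 of_nat_0_le_iff)
    also have "\<dots> \<le> kdim * ?\<mu>\<^sup>2 * (2 / \<alpha> * gap x)"
      using dist by (intro mult_left_mono) auto
    also have "\<dots> = \<kappa> * gap x"
      using that by (simp add: kappa_def Let_def)
    finally show "(sqrt kdim * ?\<mu> * norm (z - x))\<^sup>2 \<le> \<kappa> * gap x" .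
  qed
  moreover have "0 \<le> sqrt (\<kappa> * gap x)"
    using kappa_nonneg gap_nonneg[OF xK] by simp
  ultimately have "sum p J \<le> gap x / \<delta> + sqrt (\<kappa> * gap x)"
    using le by (smt (verit))
  then show thesis using that[OF z dist p] by blast
qed

lemma nep_step_in_K:
  assumes "nep_step f K \<beta> \<rho> x x'"
  shows "x \<in> K"
proof -
  from assms obtain k :: nat and c v where *: "\<forall>i\<in>{1..k}. v i \<in> vertices K \<and> 0 \<le> c i"
    "(\<Sum>i=1..k. c i) = 1" "x = (\<Sum>i=1..k. c i *\<^sub>R v i)"
    unfolding nep_step_def by blast
  show ?thesis
    unfolding *(3) using *(1,2) vertices_subset by (intro convex_sum convex_K) auto
qed

text \<open>The comparison point replaces a fraction \<open>1 / (2 * M)\<close> of the transported mass by the oracle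
  vertex; \<open>\<rho> = \<eta> / (2 * M)\<close> is just large enough for the proximal term of the oracle to absorb
  the distance of that vertex from \<open>x\<close>.\<close>

lemma nep_step_progress:
  assumes step: "nep_step f K \<beta> (\<eta> / (2 * M)) x x'" and M: "M \<ge> 1 / 2"
    and \<eta>: "0 \<le> \<eta>" "\<eta> \<le> 1" and mass: "\<eta> = 1 \<or> gap x / \<delta> + sqrt (\<kappa> * gap x) \<le> \<eta>"
    and gap: "gap x \<le> h"
    and h: "4 * \<beta> / \<alpha> * h + 4 * \<beta> * \<eta>\<^sup>2 * (diameter F)\<^sup>2 \<le> M * h"
  shows "gap x' \<le> (1 - 1 / (4 * M)) * h"
proof -
  obtain k :: nat and c v where cv: "\<forall>i\<in>{1..k}. v i \<in> vertices K \<and> 0 \<le> c i"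
    "(\<Sum>i=1..k. c i) = 1" "x = (\<Sum>i=1..k. c i *\<^sub>R v i)"
    and nep: "is_arg_min (\<lambda>u. u \<bullet> gradient f x + \<beta> * (\<eta> / (2 * M)) * (norm (u - x))\<^sup>2)
          (\<lambda>u. u \<in> vertices K) (v (k + 1))"
    and update: "is_arg_min (\<lambda>y. y \<bullet> gradient f x + \<beta> / 2 * (norm (y - x))\<^sup>2)
           (\<lambda>y. y \<in> convex hull (v ` {1..k + 1})) x' \<or>
         is_arg_min f (\<lambda>y. y \<in> convex hull (v ` {1..k + 1})) x'"
    using step unfolding nep_step_def by blast
  have J: "finite {1..k}" "\<And>j. j \<in> {1..k} \<Longrightarrow> v j \<in> vertices K"
    "\<And>j. j \<in> {1..k} \<Longrightarrow> 0 \<le> c j" "sum c {1..k} = 1"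
    using cv by auto
  obtain z p u where z: "z \<in> minimizers f K" and dist: "(norm (z - x))\<^sup>2 \<le> 2 / \<alpha> * gap x"
    and p: "\<And>j. j \<in> {1..k} \<Longrightarrow> 0 \<le> p j" "\<And>j. j \<in> {1..k} \<Longrightarrow> p j \<le> c j" and uF: "u \<in> F"
    and zx: "z - x = (\<Sum>j=1..k. p j *\<^sub>R (u - v j))"
    and le: "sum p {1..k} \<le> gap x / \<delta> + sqrt (\<kappa> * gap x)"
    by (rule transport_to_minimizer[OF J cv(3)]) blast+
  have xK: "x \<in> K" using step by (rule nep_step_in_K)
  have zF: "z \<in> F" and zK: "z \<in> K" using z min_F F_subset_K by auto
  define g where "g = gradient f x"
  define e where "e = v (k + 1)"
  define s where "s = 1 / (2 * M)"
  define d where "d = sum p {1..k}"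
  define D where "D = diameter F"
  define N where "N = norm (z - x)"
  define E where "E = norm (e - x)"
  have s: "0 < s" "s \<le> 1" "s * M = 1 / 2" using M by (auto simp: s_def)
  have d: "0 \<le> d" "d \<le> \<eta>" "d \<le> 1"
  proof -
    have "d \<le> 1" using sum_mono[of "{1..k}" p c] p(2) cv(2) by (simp add: d_def)
    then show "d \<le> 1" "d \<le> \<eta>" using mass le by (auto simp: d_def)
    show "0 \<le> d" unfolding d_def using p(1) by (intro sum_nonneg)
  qed
  have diam: "norm (q - r) \<le> D" if "q \<in> F" "r \<in> F" for q r
    using diameter_bounded_bound[OF compact_imp_bounded[OF compact_F] that]
    by (simp add: dist_norm D_def)
  have D0: "0 \<le> D" using diam[OF uF uF] by simp
  have eK: "e \<in> K" using nep vertices_subset by (auto simp: is_arg_min_def e_def)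
  \<comment> \<open>The comparison point: the fraction \<open>s\<close> of each \<open>p j\<close>
    moves to the oracle vertex \<open>e\<close>.\<close>
  define y where "y = x + s *\<^sub>R (\<Sum>j=1..k. p j *\<^sub>R (e - v j))"
  have hullK: "convex hull (v ` {1..k + 1}) \<subseteq> K"
  proof (intro hull_minimal convex_K image_subsetI)
    fix i assume "i \<in> {1..k + 1}"
    then show "v i \<in> K" using cv(1) eK vertices_subset by (cases "i = k + 1") (auto simp: e_def)
  qed
  have yhull: "y \<in> convex hull (v ` {1..k + 1})"
  proof -
    define w where "w j = (if j = k + 1 then s * d else c j - s * p j)" for j
    have "y = (\<Sum>j=1..k + 1. w j *\<^sub>R v j)"
    proof -
      have "(\<Sum>j=1..k. w j *\<^sub>R v j) = (\<Sum>j=1..k. (c j - s * p j) *\<^sub>R v j)"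
        by (intro sum.cong) (auto simp: w_def)
      then show ?thesis
        by (simp add: w_def y_def cv(3) e_def d_def scaleR_diff_right scaleR_diff_left sum_subtractf
            scaleR_right.sum scaleR_left.sum sum_distrib_left)
    qed
    also have "\<dots> \<in> convex hull (v ` {1..k + 1})"
    proof (rule convex_sum)
      have "(\<Sum>j=1..k. w j) = (\<Sum>j=1..k. c j - s * p j)"
        by (intro sum.cong) (auto simp: w_def)
      then show "sum w {1..k + 1} = 1"
        using cv(2) by (simp add: w_def d_def sum_subtractf flip: sum_distrib_left)
      fix j assume j: "j \<in> {1..k + 1}"
      show "0 \<le> w j"
      proof (cases "j = k + 1")
        case False
        then have "0 \<le> p j" "p j \<le> c j" using p[of j] j by auto
        moreover from this have "s * p j \<le> 1 * p j" using s by (intro mult_right_mono) auto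
        ultimately show ?thesis using False by (simp add: w_def)
      qed (use s d in \<open>simp add: w_def\<close>)
      show "v j \<in> convex hull (v ` {1..k + 1})" using j by (intro hull_inc) auto
    qed auto
    finally show ?thesis .
  qed
  then have yK: "y \<in> K" using hullK by blast
  have descent: "f x' \<le> f x + (y - x) \<bullet> g + \<beta> / 2 * (norm (y - x))\<^sup>2"
    using update
  proof
    assume a: "is_arg_min (\<lambda>y. y \<bullet> gradient f x + \<beta> / 2 * (norm (y - x))\<^sup>2)
           (\<lambda>y. y \<in> convex hull (v ` {1..k + 1})) x'"
    then have "x' \<in> K" using hullK by (auto simp: is_arg_min_def)
    then have "f x' \<le> f x + (x' - x) \<bullet> g + \<beta> / 2 * (norm (x' - x))\<^sup>2"
      unfolding g_def using smooth_over_upper_bound[OF smooth convex_K xK] by blast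
    moreover have "x' \<bullet> g + \<beta> / 2 * (norm (x' - x))\<^sup>2 \<le> y \<bullet> g + \<beta> / 2 * (norm (y - x))\<^sup>2"
      using a yhull by (auto simp: is_arg_min_def g_def not_less)
    ultimately show ?thesis by (simp add: inner_diff_left)
  next
    assume "is_arg_min f (\<lambda>y. y \<in> convex hull (v ` {1..k + 1})) x'"
    then have "f x' \<le> f y" using yhull by (auto simp: is_arg_min_def not_less)
    also have "\<dots> \<le> f x + (y - x) \<bullet> g + \<beta> / 2 * (norm (y - x))\<^sup>2"
      unfolding g_def using smooth_over_upper_bound[OF smooth convex_K xK yK] .
    finally show ?thesis .
  qed
  have yx: "y - x = s *\<^sub>R ((z - x) + d *\<^sub>R (e - u))"
  proof -
    have "(\<Sum>j=1..k. p j *\<^sub>R (e - v j)) = (\<Sum>j=1..k. p j *\<^sub>R (u - v j) + p j *\<^sub>R (e - u))"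
      by (intro sum.cong) (auto simp: algebra_simps)
    also have "\<dots> = (z - x) + d *\<^sub>R (e - u)"
      by (simp add: sum.distrib zx d_def scaleR_left.sum)
    finally show ?thesis by (simp add: y_def)
  qed
  \<comment> \<open>The coefficient of the proximal term of the oracle.\<close>
  define \<sigma> where "\<sigma> = \<beta> * (s * \<eta>)"
  have \<sigma>: "0 \<le> \<sigma>" using \<beta> s \<eta> by (simp add: \<sigma>_def)
  \<comment> \<open>The oracle compares \<open>e\<close> with vertices only. For vertices of
    \<open>F\<close> the bound is uniform, because they lie within \<open>D + N\<close> of
    \<open>x\<close>; so it defines a half-space that contains their hull and thus
    \<open>u\<close>.\<close>
  have eu: "(e - u) \<bullet> g \<le> \<sigma> * (2 * D\<^sup>2 + 2 * N\<^sup>2 - E\<^sup>2)"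
  proof -
    let ?H = "{q. g \<bullet> q \<ge> e \<bullet> g - \<sigma> * (2 * D\<^sup>2 + 2 * N\<^sup>2 - E\<^sup>2)}"
    have "q \<in> ?H" if q: "q \<in> vertices K \<inter> F" for q
    proof -
      have "e \<bullet> g + \<sigma> * E\<^sup>2 \<le> q \<bullet> g + \<sigma> * (norm (q - x))\<^sup>2"
        using nep q by (auto simp: is_arg_min_def not_less e_def g_def E_def \<sigma>_def s_def)
      moreover have "(norm (q - x))\<^sup>2 \<le> 2 * D\<^sup>2 + 2 * N\<^sup>2"
      proof -
        have "norm (q - x) \<le> norm (q - z) + norm (z - x)"
          using norm_triangle_ineq[of "q - z" "z - x"] by simp
        also have "\<dots> \<le> D + N" using diam[of q z] q zF by (simp add: N_def)
        finally have "(norm (q - x))\<^sup>2 \<le> (D + N)\<^sup>2" by (intro power_mono) auto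
        also have "\<dots> \<le> 2 * D\<^sup>2 + 2 * N\<^sup>2"
          using sum_squares_bound[of D N] by (simp add: power2_sum)
        finally show ?thesis .
      qed
      then have "\<sigma> * (norm (q - x))\<^sup>2 \<le> \<sigma> * (2 * D\<^sup>2 + 2 * N\<^sup>2)" using \<sigma> by (rule mult_left_mono)
      ultimately show ?thesis by (simp add: inner_commute right_diff_distrib)
    qed
    then have "convex hull (vertices K \<inter> F) \<subseteq> ?H"
      by (intro hull_minimal convex_halfspace_ge) auto
    then have "u \<in> ?H" using uF F_eq_hull by blast
    then show ?thesis by (simp add: inner_diff_left inner_commute[of u g])
  qed
  have lin: "(y - x) \<bullet> g \<le> s * (- gap x + d * (\<sigma> * (2 * D\<^sup>2 + 2 * N\<^sup>2 - E\<^sup>2)))"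
  proof -
    have "(z - x) \<bullet> g \<le> - gap x"
      unfolding g_def using convex_on_above_tangent[OF smooth cvx xK zK] by (simp add: min_value_eq[OF z])
    moreover have "d * ((e - u) \<bullet> g) \<le> d * (\<sigma> * (2 * D\<^sup>2 + 2 * N\<^sup>2 - E\<^sup>2))"
      using eu d by (intro mult_left_mono) auto
    moreover have "(y - x) \<bullet> g = s * ((z - x) \<bullet> g + d * ((e - u) \<bullet> g))"
      by (simp add: yx inner_add_left)
    ultimately show ?thesis using s by simp
  qed
  have quad: "(norm (y - x))\<^sup>2 \<le> s\<^sup>2 * (2 * d\<^sup>2 * E\<^sup>2 + 4 * (1 - d)\<^sup>2 * N\<^sup>2 + 4 * d\<^sup>2 * D\<^sup>2)"
  proof -
    have two: "(a + b)\<^sup>2 \<le> 2 * a\<^sup>2 + 2 * b\<^sup>2" for a b :: real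
      using sum_squares_bound[of a b] by (simp add: power2_sum)
    \<comment> \<open>Writing the displacement through \<open>e - x\<close> leaves only
      \<open>N\<close> and \<open>D\<close> besides \<open>E\<close>. The term in \<open>E\<close>
      is split off first and gets the factor 2, which the proximal term can cancel.\<close>
    have split: "(z - x) + d *\<^sub>R (e - u) = d *\<^sub>R (e - x) + ((1 - d) *\<^sub>R (z - x) + d *\<^sub>R (z - u))"
      by (simp add: algebra_simps)
    have "norm (d *\<^sub>R (e - x)) = d * E" "norm ((1 - d) *\<^sub>R (z - x)) = (1 - d) * N"
      using d by (auto simp: E_def N_def)
    moreover have "norm (d *\<^sub>R (z - u)) \<le> d * D"
      using diam[OF zF uF] d by (simp add: mult_left_mono)
    ultimately have "norm ((z - x) + d *\<^sub>R (e - u)) \<le> d * E + ((1 - d) * N + d * D)"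
      unfolding split
      using norm_triangle_ineq[of "d *\<^sub>R (e - x)" "(1 - d) *\<^sub>R (z - x) + d *\<^sub>R (z - u)"]
        norm_triangle_ineq[of "(1 - d) *\<^sub>R (z - x)" "d *\<^sub>R (z - u)"] by linarith
    then have "(norm ((z - x) + d *\<^sub>R (e - u)))\<^sup>2 \<le> (d * E + ((1 - d) * N + d * D))\<^sup>2"
      by (intro power_mono) auto
    also have "\<dots> \<le> 2 * (d * E)\<^sup>2 + 2 * (2 * ((1 - d) * N)\<^sup>2 + 2 * (d * D)\<^sup>2)"
      by (rule order_trans[OF two]) (intro add_left_mono mult_left_mono two; simp)
    finally have "(norm ((z - x) + d *\<^sub>R (e - u)))\<^sup>2
        \<le> 2 * d\<^sup>2 * E\<^sup>2 + 4 * (1 - d)\<^sup>2 * N\<^sup>2 + 4 * d\<^sup>2 * D\<^sup>2"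
      by (simp add: power_mult_distrib)
    then show ?thesis
      unfolding yx norm_scaleR power_mult_distrib power2_abs by (rule mult_left_mono) simp
  qed
  have "f x' - f x \<le> (y - x) \<bullet> g + \<beta> / 2 * (norm (y - x))\<^sup>2"
    using descent by simp
  also have "\<dots> \<le> s * (- gap x + d * (\<sigma> * (2 * D\<^sup>2 + 2 * N\<^sup>2 - E\<^sup>2)))
      + \<beta> / 2 * (s\<^sup>2 * (2 * d\<^sup>2 * E\<^sup>2 + 4 * (1 - d)\<^sup>2 * N\<^sup>2 + 4 * d\<^sup>2 * D\<^sup>2))"
    using \<beta> by (intro add_mono lin mult_left_mono quad) simp
  \<comment> \<open>The coefficient of the squared \<open>E\<close> is nonpositive because
    \<open>d \<le> \<eta>\<close>; hence the unknown distance of \<open>e\<close> from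
    \<open>x\<close> drops out.\<close>
  also have "\<dots> = - s * gap x + \<beta> * s\<^sup>2 * ((2 * (d * \<eta>) + 2 * (1 - d)\<^sup>2) * N\<^sup>2
      + (2 * (d * \<eta>) + 2 * d\<^sup>2) * D\<^sup>2 - (d * \<eta> - d\<^sup>2) * E\<^sup>2)"
    by (simp add: \<sigma>_def algebra_simps power2_eq_square)
  also have "\<dots> \<le> - s * gap x + \<beta> * s\<^sup>2 * (4 / \<alpha> * h + 4 * \<eta>\<^sup>2 * D\<^sup>2)"
  proof -
    have d\<eta>: "d * \<eta> \<le> d" "d * \<eta> \<le> \<eta>\<^sup>2" "d\<^sup>2 \<le> d * \<eta>" "d\<^sup>2 \<le> d"
      using d \<eta> by (auto simp: power2_eq_square mult_left_le mult_mono)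
    have "(2 * (d * \<eta>) + 2 * (1 - d)\<^sup>2) * N\<^sup>2 \<le> 2 * N\<^sup>2"
      using d\<eta> by (intro mult_right_mono) (auto simp: power2_diff)
    also have "\<dots> \<le> 4 / \<alpha> * gap x"
      using mult_left_mono[OF dist, of 2] by (simp add: N_def)
    also have "\<dots> \<le> 4 / \<alpha> * h"
      using gap \<alpha> by (intro mult_left_mono) auto
    finally have "(2 * (d * \<eta>) + 2 * (1 - d)\<^sup>2) * N\<^sup>2 \<le> 4 / \<alpha> * h" .
    moreover have "(2 * (d * \<eta>) + 2 * d\<^sup>2) * D\<^sup>2 \<le> 4 * \<eta>\<^sup>2 * D\<^sup>2"
      using d\<eta> by (intro mult_right_mono) auto
    moreover have "0 \<le> (d * \<eta> - d\<^sup>2) * E\<^sup>2"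
      using d\<eta> by simp
    ultimately show ?thesis
      using \<beta> by (intro add_left_mono mult_left_mono) auto
  qed
  also have "\<beta> * s\<^sup>2 * (4 / \<alpha> * h + 4 * \<eta>\<^sup>2 * D\<^sup>2)
      = s * (s * (4 * \<beta> / \<alpha> * h + 4 * \<beta> * \<eta>\<^sup>2 * D\<^sup>2))"
    by (simp add: algebra_simps power2_eq_square)
  also have "\<dots> \<le> s * (s * (M * h))"
    using h s by (intro mult_left_mono) (auto simp: D_def)
  also have "\<dots> = s * (h / 2)"
    using s(3) by (metis mult.assoc mult.commute times_divide_eq_right mult_1_right)
  finally have "gap x' \<le> (1 - s) * gap x + s * (h / 2)"
    by (simp add: algebra_simps)
  also have "\<dots> \<le> (1 - s) * h + s * (h / 2)"
    using gap s by (intro add_right_mono mult_left_mono) auto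
  also have "\<dots> = (1 - 1 / (4 * M)) * h"
    by (simp add: s_def algebra_simps)
  finally show ?thesis .
qed

section \<open>From one step to linear rates\<close>

text \<open>Induction along the envelope \<open>h\<close>. The mass condition ranges over all gaps
  below \<open>h t\<close>, since only this bound on the true gap is known; \<open>T\<close> allows
  the schedule to change after finitely many steps.\<close>

lemma linear_rate:
  fixes x :: "nat \<Rightarrow> real ^ 'd" and \<eta> :: "nat \<Rightarrow> real" and H M :: real and t0 T :: nat
  defines "h \<equiv> \<lambda>t. H * exp (- ((real t - real t0) / (4 * M)))"
  assumes M: "M \<ge> 1 / 2" and H: "gap (x t0) \<le> H" "0 \<le> H"
    and step: "\<And>t. t0 \<le> t \<Longrightarrow> t < T \<Longrightarrow> nep_step f K \<beta> (\<eta> t / (2 * M)) (x t) (x (t + 1))"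
    and \<eta>: "\<And>t. t0 \<le> t \<Longrightarrow> 0 \<le> \<eta> t \<and> \<eta> t \<le> 1"
    and mass: "\<And>t g. t0 \<le> t \<Longrightarrow> 0 \<le> g \<Longrightarrow> g \<le> h t \<Longrightarrow> \<eta> t = 1 \<or> g / \<delta> + sqrt (\<kappa> * g) \<le> \<eta> t"
    and rate: "\<And>t. t0 \<le> t \<Longrightarrow> 4 * \<beta> / \<alpha> * h t + 4 * \<beta> * (\<eta> t)\<^sup>2 * (diameter F)\<^sup>2 \<le> M * h t"
    and t: "t0 \<le> t" "t \<le> T"
  shows "gap (x t) \<le> h t"
  using t
proof (induction t rule: dec_induct)
  case base
  then show ?case using H by (simp add: h_def)
next
  case (step t)
  have st: "nep_step f K \<beta> (\<eta> t / (2 * M)) (x t) (x (t + 1))"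
    using step.hyps step.prems by (intro assms(5)) auto
  have gap: "gap (x t) \<le> h t" using step by simp
  have "0 \<le> gap (x t)" using gap_nonneg nep_step_in_K[OF st] by blast
  then have "gap (x (t + 1)) \<le> (1 - 1 / (4 * M)) * h t"
    using nep_step_progress[OF st M _ _ mass gap rate] \<eta>[of t] gap step.hyps by blast
  \<comment> \<open>Uses \<open>1 - y \<le> exp (- y)\<close>.\<close>
  also have "\<dots> \<le> exp (- (1 / (4 * M))) * h t"
    using exp_ge_add_one_self[of "- (1 / (4 * M))"] H(2)
    by (intro mult_right_mono) (auto simp: h_def)
  also have "\<dots> = h (Suc t)"
    by (simp add: h_def flip: exp_add) (simp add: diff_divide_distrib add_divide_distrib)
  finally show ?case by simp
qed

text \<open>The squared \<eta> is at most \<open>2 * P * h t\<close>, which accounts for the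
  constant 8 in the bound on \<open>M\<close>.\<close>

lemma first_phase:
  fixes x :: "nat \<Rightarrow> real ^ 'd" and T :: nat
  assumes M: "M \<ge> max (4 * \<beta> / \<alpha> + 8 * \<beta> * (diameter F)\<^sup>2 * max (2 * \<kappa>) (1 / \<delta>)) (1 / 2)"
    and C: "C \<ge> gap (x 1)" "0 \<le> C"
    and step: "\<And>t. 1 \<le> t \<Longrightarrow> t < T \<Longrightarrow> nep_step f K \<beta> (rho_first \<kappa> \<delta> C M t) (x t) (x (t + 1))"
    and t: "1 \<le> t" "t \<le> T"
  shows "gap (x t) \<le> C * exp (- ((real t - 1) / (4 * M)))"
proof -
  define P where "P = max (2 * \<kappa>) (1 / \<delta>)"
  define h where "h t = C * exp (- ((real t - real 1) / (4 * M)))" for t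
  define \<eta> where "\<eta> t = min (sqrt (2 * P * h t)) 1" for t
  have P: "2 * \<kappa> \<le> P" "1 / \<delta> \<le> P" "0 \<le> P"
    using kappa_nonneg by (auto simp: P_def le_max_iff_disj)
  have h: "0 \<le> h t" for t using C(2) by (simp add: h_def)
  have "gap (x t) \<le> h t"
  proof (rule linear_rate[where \<eta> = \<eta> and H = C and M = M and x = x and ?t0.0 = 1 and T = T, folded h_def])
    show "M \<ge> 1 / 2" using M by simp
    show "nep_step f K \<beta> (\<eta> t / (2 * M)) (x t) (x (t + 1))" if "1 \<le> t" "t < T" for t
      using step[OF that] by (simp add: rho_first_def \<eta>_def h_def P_def mult.assoc)
    show "0 \<le> \<eta> t \<and> \<eta> t \<le> 1" for t
      using P h by (simp add: \<eta>_def)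
    show "4 * \<beta> / \<alpha> * h t + 4 * \<beta> * (\<eta> t)\<^sup>2 * (diameter F)\<^sup>2 \<le> M * h t" for t
    proof -
      have "(\<eta> t)\<^sup>2 \<le> (sqrt (2 * P * h t))\<^sup>2"
        using P h by (intro power_mono) (auto simp: \<eta>_def)
      then have "(\<eta> t)\<^sup>2 \<le> 2 * P * h t" using P h by simp
      then have "4 * \<beta> * (\<eta> t)\<^sup>2 * (diameter F)\<^sup>2 \<le> 4 * \<beta> * (2 * P * h t) * (diameter F)\<^sup>2"
        using \<beta> by (intro mult_right_mono mult_left_mono) auto
      moreover have "(4 * \<beta> / \<alpha> + 8 * \<beta> * (diameter F)\<^sup>2 * P) * h t \<le> M * h t"
        using M h by (intro mult_right_mono) (auto simp: P_def)
      ultimately show ?thesis by (simp add: algebra_simps)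
    qed
    show "\<eta> t = 1 \<or> g / \<delta> + sqrt (\<kappa> * g) \<le> \<eta> t" if g: "0 \<le> g" "g \<le> h t" for t g
    proof (cases "2 * P * h t \<ge> 1")
      case False
      \<comment> \<open>Both parts of the mass are at most \<open>sqrt (q / 2)\<close>, the linear
        one because \<open>q \<le> 1 / 2\<close>; together they give exactly
        \<open>sqrt (2 * q)\<close>.\<close>
      define q where "q = P * h t"
      have q: "0 \<le> q" "q \<le> 1 / 2" using False P h by (auto simp: q_def)
      have "1 / \<delta> * g \<le> q" unfolding q_def using P g by (intro mult_mono) auto
      then have "g / \<delta> \<le> q" by simp
      moreover have "sqrt (\<kappa> * g) \<le> sqrt (q / 2)"
      proof -
        have "2 * \<kappa> * g \<le> P * h t" using P g by (intro mult_mono) auto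
        then show ?thesis by (simp add: q_def)
      qed
      moreover have "q \<le> sqrt (q / 2)"
        using mult_left_mono[OF q(2) q(1)] by (intro real_le_rsqrt) (simp add: power2_eq_square)
      moreover have "2 * sqrt (q / 2) = sqrt (2 * q)"
        using real_sqrt_mult[of 4 "q / 2"] by simp
      moreover have "\<eta> t = sqrt (2 * q)"
        using False by (simp add: \<eta>_def q_def mult.assoc min_def)
      ultimately have "g / \<delta> + sqrt (\<kappa> * g) \<le> \<eta> t" by linarith
      then show ?thesis ..
    qed (simp add: \<eta>_def)
  qed (use C t in auto)
  then show ?thesis by (simp add: h_def)
qed

text \<open>Once the gap is below \<open>\<delta>\<^sup>2 * \<kappa>\<close>, both parts of the mass
  are at most \<open>\<delta> * \<kappa> * r t\<close>. The squared \<eta> is then at most \<kappa>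
  times four times the envelope, which accounts for the constant 16.\<close>

lemma second_phase:
  fixes x :: "nat \<Rightarrow> real ^ 'd" and \<tau> :: nat
  assumes M: "M \<ge> max (4 * \<beta> / \<alpha> + 16 * \<beta> * \<kappa> * (diameter F)\<^sup>2) (1 / 2)"
    and start: "gap (x \<tau>) \<le> \<delta>\<^sup>2 * \<kappa>"
    and step: "\<And>t. \<tau> \<le> t \<Longrightarrow> nep_step f K \<beta> (rho_second \<kappa> \<delta> M \<tau> t) (x t) (x (t + 1))"
    and t: "\<tau> \<le> t"
  shows "gap (x t) \<le> \<delta>\<^sup>2 * \<kappa> * exp (- ((real t - real \<tau>) / (4 * M)))"
proof -
  \<comment> \<open>The rate is halved because the envelope is the square of
    \<open>r\<close>.\<close>
  define r where "r t = exp (- ((real t - real \<tau>) / (8 * M)))" for t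
  define \<eta> where "\<eta> t = min (2 * \<delta> * \<kappa> * r t) 1" for t
  have M0: "M \<ge> 1 / 2" using M by simp
  have r2: "exp (- ((real t - real \<tau>) / (4 * M))) = (r t)\<^sup>2" for t
    using M0 by (simp add: r_def field_simps flip: exp_double)
  have r: "0 < r t" for t by (simp add: r_def)
  note \<kappa> = kappa_nonneg
  show ?thesis
  proof (rule linear_rate[where \<eta> = \<eta> and x = x and ?t0.0 = \<tau> and T = t, OF M0 start], unfold r2)
    show "nep_step f K \<beta> (\<eta> t / (2 * M)) (x t) (x (t + 1))" if "\<tau> \<le> t" for t
      using step[OF that] by (simp add: rho_second_def \<eta>_def r_def)
    show "0 \<le> \<eta> t \<and> \<eta> t \<le> 1" for t
      using \<delta> \<kappa> r[of t] by (simp add: \<eta>_def)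
    show "4 * \<beta> / \<alpha> * (\<delta>\<^sup>2 * \<kappa> * (r t)\<^sup>2) + 4 * \<beta> * (\<eta> t)\<^sup>2 * (diameter F)\<^sup>2
        \<le> M * (\<delta>\<^sup>2 * \<kappa> * (r t)\<^sup>2)" for t
    proof -
      let ?h = "\<delta>\<^sup>2 * \<kappa> * (r t)\<^sup>2"
      have "(\<eta> t)\<^sup>2 \<le> (2 * \<delta> * \<kappa> * r t)\<^sup>2"
        using \<delta> \<kappa> r[of t] by (intro power_mono) (auto simp: \<eta>_def)
      also have "\<dots> = 4 * \<kappa> * ?h" by (simp add: power2_eq_square)
      finally have "4 * \<beta> * (\<eta> t)\<^sup>2 * (diameter F)\<^sup>2 \<le> 4 * \<beta> * (4 * \<kappa> * ?h) * (diameter F)\<^sup>2"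
        using \<beta> by (intro mult_right_mono mult_left_mono) auto
      moreover have "(4 * \<beta> / \<alpha> + 16 * \<beta> * \<kappa> * (diameter F)\<^sup>2) * ?h \<le> M * ?h"
        using M \<kappa> by (intro mult_right_mono) auto
      ultimately show ?thesis by (simp add: algebra_simps)
    qed
    show "\<eta> t = 1 \<or> g / \<delta> + sqrt (\<kappa> * g) \<le> \<eta> t"
      if "\<tau> \<le> t" and g: "0 \<le> g" "g \<le> \<delta>\<^sup>2 * \<kappa> * (r t)\<^sup>2" for t g
    proof -
      have r1: "r t \<le> 1" using that(1) M0 by (simp add: r_def)
      have "g / \<delta> \<le> \<delta>\<^sup>2 * \<kappa> * (r t)\<^sup>2 / \<delta>" using g \<delta> by (intro divide_right_mono) auto
      also have "\<dots> = \<delta> * \<kappa> * (r t * r t)" using \<delta> by (simp add: power2_eq_square)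
      also have "\<dots> \<le> \<delta> * \<kappa> * (r t * 1)"
        using r1 r[of t] \<delta> \<kappa> by (intro mult_left_mono) auto
      finally have "g / \<delta> \<le> \<delta> * \<kappa> * r t" by simp
      moreover have "sqrt (\<kappa> * g) \<le> \<delta> * \<kappa> * r t"
      proof (rule real_le_lsqrt)
        have "\<kappa> * g \<le> \<kappa> * (\<delta>\<^sup>2 * \<kappa> * (r t)\<^sup>2)" using g \<kappa> by (intro mult_left_mono) auto
        then show "\<kappa> * g \<le> (\<delta> * \<kappa> * r t)\<^sup>2" by (simp add: power2_eq_square mult_ac)
      qed (use \<delta> \<kappa> r[of t] in auto)
      ultimately show ?thesis by (auto simp: \<eta>_def min_def)
    qed
  qed (use \<delta> \<kappa> t in auto)
qed

end

theorem theorem4: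
  fixes m1 m2 :: nat
    and A1 A2 :: "nat \<Rightarrow> real ^ 'd" and b1 b2 :: "nat \<Rightarrow> real"
    and K F :: "(real ^ 'd) set" and f :: "real ^ 'd \<Rightarrow> real"
    and \<alpha> \<beta> \<delta> \<kappa> M1 M2 C :: real
    and \<rho> :: "nat \<Rightarrow> real" and x :: "nat \<Rightarrow> real ^ 'd"
  assumes K: "K = {y. (\<forall>i\<in>{1..m1}. A1 i \<bullet> y = b1 i) \<and> (\<forall>i\<in>{1..m2}. A2 i \<bullet> y \<le> b2 i)}"
    and "compact K"
    and "convex_on K f"
    and "\<beta> > 0" and "smooth_over f \<beta> K"
    and "\<alpha> > 0" and "quadratic_growth f K \<alpha>"
    and F: "lowest_dim_face_containing m1 A1 m2 A2 b2 K (minimizers f K) F"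
    and "\<delta> > 0" and "strict_complementarity f K F \<delta>"
    and kappa: "\<kappa> = kappa m1 A1 m2 A2 b2 K F \<alpha>"
    and M1: "M1 \<ge> max (4 * \<beta> / \<alpha> + 8 * \<beta> * (diameter F)\<^sup>2 * max (2 * \<kappa>) (1 / \<delta>)) (1 / 2)"
    and M2: "M2 \<ge> max (4 * \<beta> / \<alpha> + 16 * \<beta> * \<kappa> * (diameter F)\<^sup>2) (1 / 2)"
    and C: "C \<ge> f (x 1) - min_value f K"
    and iterates: "nep_frank_wolfe f K \<beta> \<rho> x"
  shows "((\<forall>t\<ge>1. \<rho> t = rho_first \<kappa> \<delta> C M1 t) \<longrightarrow>
            (\<forall>t\<ge>1. f (x t) - min_value f K \<le> C * exp (- ((real t - 1) / (4 * M1))))) \<and>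
         (2 * \<kappa> \<le> 1 / \<delta> \<and> face_dim m1 A1 m2 A2 b2 F > 0 \<longrightarrow>
            (\<forall>\<tau>::nat. \<tau> \<ge> 1 \<and> real \<tau> \<ge> 4 * M1 * ln (C / (\<delta>\<^sup>2 * \<kappa>)) + 1 \<and>
               (\<forall>t\<ge>1. t < \<tau> \<longrightarrow> \<rho> t = rho_first \<kappa> \<delta> C M1 t) \<and>
               (\<forall>t\<ge>\<tau>. \<rho> t = rho_second \<kappa> \<delta> M2 \<tau> t) \<longrightarrow>
               (\<forall>t\<ge>\<tau>. f (x t) - min_value f K \<le> \<delta>\<^sup>2 * \<kappa> * exp (- ((real t - real \<tau>) / (4 * M2))))))"
proof -
  have x1: "x 1 \<in> K"
    using iterates by (auto simp: nep_frank_wolfe_def vertices_def extreme_point_of_def)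
  have step: "nep_step f K \<beta> (\<rho> t) (x t) (x (t + 1))" if "1 \<le> t" for t
    using iterates that by (simp add: nep_frank_wolfe_def)
  have face: "F face_of K" "minimizers f K \<subseteq> F"
    using F by (auto simp: lowest_dim_face_containing_def)
  have "F \<noteq> {}"
    using minimizers_nonempty[OF \<open>compact K\<close> _ smooth_over_continuous_on[OF \<open>smooth_over f \<beta> K\<close>]]
      x1 face(2) by auto
  interpret nep_setting m1 m2 A1 A2 b1 b2 K F f \<alpha> \<beta> \<delta>
    by (unfold_locales; fact)
  have C0: "0 \<le> C" using C gap_nonneg[OF x1] by simp
  \<comment> \<open>The cutoff \<open>T\<close> serves both claims: \<rho> must follow the first
    schedule only strictly before \<open>T\<close>, yet the bound still holds at \<open>T\<close>,
    in particular at \<tau>.\<close>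
  have first: "gap (x t) \<le> C * exp (- ((real t - 1) / (4 * M1)))"
    if "\<forall>t\<ge>1. t < T \<longrightarrow> \<rho> t = rho_first \<kappa> \<delta> C M1 t" "1 \<le> t" "t \<le> T" for t T
  proof (rule first_phase[where x = x and T = T, OF M1[unfolded kappa] C C0 _ that(2,3)])
    show "nep_step f K \<beta> (rho_first (kappa m1 A1 m2 A2 b2 K F \<alpha>) \<delta> C M1 t) (x t) (x (t + 1))"
      if "1 \<le> t" "t < T" for t
      using step[OF that(1)] \<open>\<forall>t\<ge>1. t < T \<longrightarrow> \<rho> t = rho_first \<kappa> \<delta> C M1 t\<close> that kappa by simp
  qed
  show ?thesis
  proof (intro conjI impI allI)
    fix t :: nat assume "\<forall>t\<ge>1. \<rho> t = rho_first \<kappa> \<delta> C M1 t" "t \<ge> 1"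
    then show "gap (x t) \<le> C * exp (- ((real t - 1) / (4 * M1)))"
      using first[of t t] by blast
  next
    fix \<tau> t :: nat
    assume "2 * \<kappa> \<le> 1 / \<delta> \<and> kdim > 0"
      and \<tau>: "\<tau> \<ge> 1 \<and> real \<tau> \<ge> 4 * M1 * ln (C / (\<delta>\<^sup>2 * \<kappa>)) + 1 \<and>
               (\<forall>t\<ge>1. t < \<tau> \<longrightarrow> \<rho> t = rho_first \<kappa> \<delta> C M1 t) \<and>
               (\<forall>t\<ge>\<tau>. \<rho> t = rho_second \<kappa> \<delta> M2 \<tau> t)"
      and t: "t \<ge> \<tau>"
    then have \<kappa>: "0 < \<delta>\<^sup>2 * \<kappa>" using kappa_pos kappa \<open>\<delta> > 0\<close> by simp
    have M1_pos: "M1 > 0" using M1 by simp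
    have "gap (x \<tau>) \<le> C * exp (- ((real \<tau> - 1) / (4 * M1)))"
      using first[of \<tau> \<tau>] \<tau> by blast
    \<comment> \<open>The choice of \<tau> makes the first envelope fall to the start value of the
      second. For \<open>C = 0\<close> the logarithm is only a default value, but the envelope is
      0.\<close>
    also have "\<dots> \<le> \<delta>\<^sup>2 * \<kappa>"
    proof (cases "C = 0")
      case False
      then have "C > 0" using C0 by simp
      have "ln (C / (\<delta>\<^sup>2 * \<kappa>)) \<le> (real \<tau> - 1) / (4 * M1)"
        using \<tau> M1_pos by (simp add: field_simps)
      then have "exp (- ((real \<tau> - 1) / (4 * M1))) \<le> exp (- ln (C / (\<delta>\<^sup>2 * \<kappa>)))"
        by simp
      also have "\<dots> = \<delta>\<^sup>2 * \<kappa> / C"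
        using \<open>C > 0\<close> \<kappa> by (simp add: exp_minus)
      finally show ?thesis using \<open>C > 0\<close> by (simp add: field_simps)
    qed (use \<kappa> in simp)
    finally have start: "gap (x \<tau>) \<le> \<delta>\<^sup>2 * kappa m1 A1 m2 A2 b2 K F \<alpha>" using kappa by simp
    have "nep_step f K \<beta> (rho_second (kappa m1 A1 m2 A2 b2 K F \<alpha>) \<delta> M2 \<tau> t) (x t) (x (t + 1))"
      if "\<tau> \<le> t" for t
      using step[of t] \<tau> that kappa by simp
    from second_phase[OF M2[unfolded kappa] start this t]
    show "gap (x t) \<le> \<delta>\<^sup>2 * \<kappa> * exp (- ((real t - real \<tau>) / (4 * M2)))"
      using kappa by simp
  qed
qed

end
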